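(* Let $1\leq d\leq r$ and $n\geq1$ be integers and let $C\in\mathbb{R}^{dn\times dn}$ be real symmetric positive semidefinite with $d\times d$ blocks $C_{ij}$. Let $X_1,\dots,X_n\in\mathbb{R}^{d\times nd}$ be an optimal solution of \[ \max_{\substack{X_iX_i^T=I_{d\times d},\ X_i\in\mathbb{R}^{d\times nd}}}\ \sum_{i=1}^n\sum_{j=1}^n\operatorname{tr}\left(C_{ij}^TX_iX_j^T\right), \] let $R\in\mathbb{R}^{nd\times r}$ have i.i.d. real $\mathcal{N}(0,\frac1r)$ entries, and let $V_i=\mathcal{P}_{(d,r)}(X_iR)\in\mathcal{O}_{(d,r)}$. Then \[ \mathbb{E} \left[ \sum_{i=1}^n\sum_{j=1}^n\operatorname{tr}\left(C_{ij}^TV_iV_j^T\right) \right] \geq \alpha_{\mathbb{R}}(d,r)^2 \max_{O_1,\dots,O_n \in \mathcal{O}_{(d,r)}} \sum_{i=1}^n\sum_{j=1}^n\operatorname{tr}\left(C_{ij}^TO_iO_j^T\right). \]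
   Context: $\mathcal{O}_{(d,r)}=\{O\in\mathbb{R}^{d\times r}: OO^T=I_{d\times d}\}$ is the Stiefel manifold. For $X\in\mathbb{R}^{d\times r}$, $\mathcal{P}_{(d,r)}(X)=\operatorname{argmin}_{Z\in\mathcal{O}_{(d,r)}}\|Z-X\|_F$ (if $X=U[\Sigma\ 0]V^T$ is an SVD, this is $U[I_{d\times d}\ 0]V^T$). For $G\in\mathbb{R}^{d\times r}$ with i.i.d. real $\mathcal{N}(0,\frac1r)$ entries, $\alpha_{\mathbb{R}}(d,r)=\mathbb{E}\left[\frac1d\sum_{j=1}^d\sigma_j(G)\right]$, where $\sigma_j$ is the $j$-th singular value. *)

theory Defs
  imports "HOL-Probability.Probability" "Jordan_Normal_Form.Char_Poly"
begin

definition mtrace :: "real mat \<Rightarrow> real" where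
  "mtrace A = (\<Sum>i<dim_row A. A $$ (i, i))"

definition frob :: "real mat \<Rightarrow> real" where
  "frob A = sqrt (\<Sum>i<dim_row A. \<Sum>j<dim_col A. (A $$ (i, j))\<^sup>2)"

definition stiefel :: "nat \<Rightarrow> nat \<Rightarrow> real mat set" where
  "stiefel d r = {Q \<in> carrier_mat d r. Q * transpose_mat Q = 1\<^sub>m d}"

definition stiefel_proj :: "nat \<Rightarrow> nat \<Rightarrow> real mat \<Rightarrow> real mat" where
  "stiefel_proj d r X =
     (SOME Z. Z \<in> stiefel d r \<and> (\<forall>W \<in> stiefel d r. frob (Z - X) \<le> frob (W - X)))"

definition psd :: "nat \<Rightarrow> real mat \<Rightarrow> bool" where
  "psd N C \<longleftrightarrow> C \<in> carrier_mat N N \<and> transpose_mat C = C \<and>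
     (\<forall>v \<in> carrier_vec N. 0 \<le> v \<bullet> (C *\<^sub>v v))"

definition blk :: "nat \<Rightarrow> real mat \<Rightarrow> nat \<Rightarrow> nat \<Rightarrow> real mat" where
  "blk d C i j = mat d d (\<lambda>(a, b). C $$ (i * d + a, j * d + b))"

definition obj :: "nat \<Rightarrow> nat \<Rightarrow> real mat \<Rightarrow> (nat \<Rightarrow> real mat) \<Rightarrow> real" where
  "obj n d C Y = (\<Sum>i<n. \<Sum>j<n.
      mtrace (transpose_mat (blk d C i j) * Y i * transpose_mat (Y j)))"

definition gauss_entries :: "nat \<Rightarrow> nat \<Rightarrow> real \<Rightarrow> ((nat \<times> nat) \<Rightarrow> real) measure" where
  "gauss_entries m k v = completion
     (PiM ({..<m} \<times> {..<k}) (\<lambda>_. density lborel (normal_density 0 (sqrt v))))"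

definition to_mat :: "nat \<Rightarrow> nat \<Rightarrow> ((nat \<times> nat) \<Rightarrow> real) \<Rightarrow> real mat" where
  "to_mat m k g = mat m k (\<lambda>(i, j). g (i, j))"

definition singular_values :: "real mat \<Rightarrow> real multiset" where
  "singular_values G = image_mset sqrt (proots (char_poly (G * transpose_mat G)))"

definition alpha_R :: "nat \<Rightarrow> nat \<Rightarrow> real" where
  "alpha_R d r = (\<integral>g. (1 / real d) * sum_mset (singular_values (to_mat d r g))
                    \<partial>gauss_entries d r (1 / real r))"

end

theory Submission
  imports Defs
begin

text \<open>
  Write V(Y) for the polar factor of Y (the projection of Y to the Stiefel manifold) and R for the
  Gaussian matrix. Left multiplication by a matrix with orthonormal rows preserves the law of R.
  Hence \<open>E [V(G) G^T]\<close> commutes with all signed permutation matrices, so it is a multiple of the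
  identity, and its trace is the expected sum of the singular values of G. The reflection
  \<open>2 X^T X - 1\<close> fixes \<open>X R\<close> and reverses \<open>W R\<close> whenever \<open>W X^T = 0\<close>, so
  \<open>E [V(X R) (Z R)^T] = \<alpha> X Z^T\<close> for all Z. Expanding the nonnegative expectation of the quadratic form
  of C at \<open>\<alpha> X_i R - V(X_i R)\<close> then gives \<open>E [obj V] \<ge> \<alpha>^2 obj X\<close>. Finally, the Gram matrix of any
  feasible point on the Stiefel manifold has size nd and therefore a factorization with inner
  dimension nd, so it is feasible for the relaxation.
\<close>

text \<open>\<open>stiefel_proj\<close> chooses among minimizers and \<open>singular_values\<close>
  is read off from the roots of a polynomial, so neither integrand is visibly Borel. The proof works
  on the almost sure event that the matrix has a decomposition with positive singular values. There
  the minimizer is unique and is the limit of an iteration with measurable entries, and the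
  completion inside \<open>gauss_entries\<close> allows the integrals to be replaced by integrals of
  measurable functions. The variance 1/r makes the expectation of \<open>(X_i R) (X_j R)^T\<close>
  equal to \<open>X_i X_j^T\<close>, since each of the r columns contributes a share 1/r. The
  coefficient alpha of \<open>X_i R\<close> is the best choice: with t in its place, the quadratic
  form gives the lower bound (2 t alpha - t^2) obj X, which is largest at t = alpha.\<close>

unbundle no inner_syntax
unbundle no vec_syntax

subsection \<open>Spectral theorem for real symmetric matrices\<close>

lemma index_mult_mat_sum:
  assumes "A \<in> carrier_mat a b" "B \<in> carrier_mat b c" "i < a" "j < c"
  shows "(A * B) $$ (i, j) = (\<Sum>k<b. A $$ (i, k) * B $$ (k, j))"
  using assms by (auto simp: scalar_prod_def atLeast0LessThan intro!: sum.cong)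

lemma transpose_mat_diag: "transpose_mat (mat_diag n f) = mat_diag n f"
  by (rule eq_matI) (auto simp: mat_diag_def)

text \<open>Over the complex numbers the characteristic polynomial splits, so some complex k is an
  eigenvalue. For an eigenvector v, the Hermitian form of A at v equals k times the squared norm of
  v, and it is its own conjugate because A is real symmetric. Hence k is real, and it is a root of
  the real characteristic polynomial.\<close>

lemma symmetric_real_eigenvalue:
  fixes A :: "real mat"
  assumes A: "A \<in> carrier_mat n n" and sym: "transpose_mat A = A" and n: "n > 0"
  shows "\<exists>k. eigenvalue A k"
proof -
  let ?Ac = "map_mat complex_of_real A"
  have Ac: "?Ac \<in> carrier_mat n n" using A by simp
  obtain as where as: "char_poly ?Ac = (\<Prod>a\<leftarrow>as. [:- a, 1:])" "length as = n"
    using char_poly_factorized[OF Ac] by blast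
  then obtain k where k: "poly (char_poly ?Ac) k = 0"
    using n by (cases as) auto
  then have "eigenvalue ?Ac k" using eigenvalue_root_char_poly[OF Ac] by simp
  then obtain v where v: "v \<in> carrier_vec n" "v \<noteq> 0\<^sub>v n" "?Ac *\<^sub>v v = k \<cdot>\<^sub>v v"
    using A unfolding eigenvalue_def eigenvector_def by auto
  have ent: "(\<Sum>j<n. complex_of_real (A $$ (i, j)) * v $ j) = k * v $ i" if "i < n" for i
  proof -
    have "(?Ac *\<^sub>v v) $ i = (\<Sum>j<n. complex_of_real (A $$ (i, j)) * v $ j)"
      using that A v(1) by (auto simp: scalar_prod_def atLeast0LessThan intro!: sum.cong)
    then show ?thesis using v that by simp
  qed
  have symij: "A $$ (i, j) = A $$ (j, i)" if "i < n" "j < n" for i j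
    using that A arg_cong[OF sym, of "\<lambda>M. M $$ (i, j)"] by simp
  define s where "s = (\<Sum>i<n. \<Sum>j<n. cnj (v $ i) * complex_of_real (A $$ (i, j)) * v $ j)"
  define N where "N = (\<Sum>i<n. (cmod (v $ i))\<^sup>2)"
  have s: "s = k * complex_of_real N"
  proof -
    have "s = (\<Sum>i<n. cnj (v $ i) * (k * v $ i))"
      unfolding s_def by (intro sum.cong refl) (simp add: ent[symmetric] sum_distrib_left mult.assoc)
    then show ?thesis
      unfolding N_def by (simp add: sum_distrib_left complex_norm_square mult_ac del: of_real_power)
  qed
  have "cnj s = s"
  proof -
    have "cnj s = (\<Sum>i<n. \<Sum>j<n. v $ i * complex_of_real (A $$ (i, j)) * cnj (v $ j))"
      unfolding s_def by simp
    also have "\<dots> = (\<Sum>j<n. \<Sum>i<n. v $ i * complex_of_real (A $$ (i, j)) * cnj (v $ j))"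
      by (rule sum.swap)
    also have "\<dots> = s"
      unfolding s_def by (intro sum.cong refl) (simp add: symij mult_ac)
    finally show ?thesis .
  qed
  obtain i where "i < n" "v $ i \<noteq> 0" using v by (metis eq_vecI index_zero_vec carrier_vecD)
  then have "N > 0" unfolding N_def by (intro sum_pos2[of _ i]) auto
  then have "cnj k = k" using \<open>cnj s = s\<close> unfolding s by simp
  then obtain x where x: "k = complex_of_real x" by (metis Reals_cnj_iff Reals_cases)
  have "complex_of_real (poly (char_poly A) x) = 0"
    using k unfolding x of_real_hom.char_poly_hom[OF A] by simp
  then show ?thesis using eigenvalue_root_char_poly[OF A] by auto
qed

text \<open>H is the Householder reflection along v - e_0, which exchanges the unit vectors e_0 and
  v. It supplies an orthogonal matrix with a prescribed first column and avoids extending v to an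
  orthonormal basis.\<close>

lemma unit_vector_householder:
  fixes v :: "real vec"
  assumes v: "v \<in> carrier_vec n" "v \<bullet> v = 1" and n: "n > 0"
  shows "\<exists>H \<in> carrier_mat n n. transpose_mat H = H \<and> H * H = 1\<^sub>m n \<and> H *\<^sub>v unit_vec n 0 = v"
proof -
  define w where "w = (\<lambda>i. v $ i - (if i = 0 then 1 else 0))"
  define q where "q = (\<Sum>i<n. (w i)\<^sup>2)"
  \<comment> \<open>If v = e_0, then q = 0 and, since division by zero gives 0, this formula is the
    identity matrix, as it should be.\<close>
  define H where "H = mat n n (\<lambda>(i, j). (if i = j then 1 else 0) - 2 / q * w i * w j)"
  have H[simp]: "H \<in> carrier_mat n n" by (simp add: H_def)
  have vv: "(\<Sum>i<n. (v $ i)\<^sup>2) = 1"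
    using v by (simp add: scalar_prod_def power2_eq_square atLeast0LessThan)
  have q: "q = 2 - 2 * v $ 0"
  proof -
    have "q = (\<Sum>i<n. (v $ i)\<^sup>2 - 2 * (if i = 0 then v $ i else 0) + (if i = 0 then 1 else 0))"
      unfolding q_def w_def by (intro sum.cong refl) (auto simp: power2_eq_square algebra_simps)
    also have "\<dots> = 1 - 2 * v $ 0 + 1"
      using n by (simp add: sum.distrib sum_subtractf vv sum_distrib_left[symmetric] sum.delta')
    finally show ?thesis by simp
  qed
  have qw: "q = 0 \<Longrightarrow> i < n \<Longrightarrow> w i = 0" for i
    unfolding q_def by (subst (asm) sum_nonneg_eq_0_iff) auto
  have HH: "H * H = 1\<^sub>m n"
  proof (rule eq_matI)
    fix i j assume ij: "i < dim_row (1\<^sub>m n)" "j < dim_col (1\<^sub>m n)"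
    let ?d = "\<lambda>i j. if i = j then 1 else (0::real)"
    have "(H * H) $$ (i, j) = (\<Sum>k<n. (?d i k - 2 / q * w i * w k) * (?d k j - 2 / q * w k * w j))"
      using ij by (simp add: H_def scalar_prod_def atLeast0LessThan)
    also have "\<dots> = (\<Sum>k<n. (if i = k then ?d k j else 0) - (if i = k then 2 / q * w k * w j else 0)
          - (if k = j then 2 / q * w i * w k else 0) + (2 / q * w i) * (2 / q * w j) * (w k)\<^sup>2)"
      by (intro sum.cong refl) (auto simp: power2_eq_square algebra_simps)
    also have "\<dots> = ?d i j - 2 / q * w i * w j - 2 / q * w i * w j + (2 / q * w i) * (2 / q * w j) * q"
      using ij by (simp only: sum.distrib sum_subtractf sum_distrib_left[symmetric] q_def[symmetric])
        (simp add: q_def[symmetric] sum.delta sum.delta')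
    also have "\<dots> = ?d i j" by (cases "q = 0") (auto simp: field_simps)
    finally show "(H * H) $$ (i, j) = 1\<^sub>m n $$ (i, j)" using ij by simp
  qed (auto simp: H_def)
  have Hv: "H *\<^sub>v unit_vec n 0 = v"
  proof (rule eq_vecI)
    fix i assume i: "i < dim_vec v"
    then have i: "i < n" using v by simp
    have "(H *\<^sub>v unit_vec n 0) $ i = H $$ (i, 0)"
      using i n by (simp add: H_def mult_mat_vec_def)
    also have "\<dots> = v $ i"
    proof (cases "q = 0")
      case True
      with qw[OF True i] i n show ?thesis by (simp add: H_def w_def split: if_splits)
    next
      case False
      have "2 / q * w 0 = - 1" using False unfolding q w_def by (simp add: field_simps)
      then have "2 / q * w i * w 0 = - w i" by (metis mult.commute mult.left_commute mult_minus1)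
      then show ?thesis using i n by (simp add: H_def w_def)
    qed
    finally show "(H *\<^sub>v unit_vec n 0) $ i = v $ i" .
  qed (use v in \<open>auto simp: H_def\<close>)
  have "transpose_mat H = H" by (rule eq_matI) (auto simp: H_def)
  then show ?thesis using HH Hv H by blast
qed

text \<open>Deflation: conjugating by a Householder matrix that sends e_0 to a unit eigenvector
  makes e_0 an eigenvector of \<open>B = H * A * H\<close>. Its first column is then k e_0, by
  symmetry so is its first row, and the induction hypothesis diagonalizes the remaining
  block.\<close>

theorem symmetric_spectral:
  fixes A :: "real mat"
  assumes "A \<in> carrier_mat n n" and "transpose_mat A = A"
  shows "\<exists>U l. U \<in> carrier_mat n n \<and> U * transpose_mat U = 1\<^sub>m n \<and> transpose_mat U * U = 1\<^sub>m n
    \<and> A = U * mat_diag n l * transpose_mat U"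
  using assms
proof (induction n arbitrary: A)
  case 0
  then show ?case
    by (intro exI[of _ "1\<^sub>m 0"] exI[of _ "\<lambda>_. 0"]) auto
next
  case (Suc n)
  note A = Suc.prems(1) and sym = Suc.prems(2)
  obtain k where "eigenvalue A k" using symmetric_real_eigenvalue[OF A sym] by auto
  then obtain x where x: "x \<in> carrier_vec (Suc n)" "x \<noteq> 0\<^sub>v (Suc n)" "A *\<^sub>v x = k \<cdot>\<^sub>v x"
    using A unfolding eigenvalue_def eigenvector_def by auto
  have xs: "x \<bullet> x = (\<Sum>i<Suc n. (x $ i)\<^sup>2)"
    using x(1) by (simp add: scalar_prod_def power2_eq_square atLeast0LessThan lessThan_Suc)
  obtain i where "i < Suc n" "x $ i \<noteq> 0" using x by (metis eq_vecI index_zero_vec carrier_vecD)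
  then have xx: "x \<bullet> x > 0" unfolding xs by (intro sum_pos2[of _ i]) auto
  define v where "v = (1 / sqrt (x \<bullet> x)) \<cdot>\<^sub>v x"
  have v: "v \<in> carrier_vec (Suc n)" using x by (simp add: v_def)
  have "v \<bullet> v = 1" using x xx by (simp add: v_def)
  then obtain H where H: "H \<in> carrier_mat (Suc n) (Suc n)" "transpose_mat H = H"
      "H * H = 1\<^sub>m (Suc n)" "H *\<^sub>v unit_vec (Suc n) 0 = v"
    using unit_vector_householder[OF v] by blast
  have Av: "A *\<^sub>v v = k \<cdot>\<^sub>v v"
    unfolding v_def using mult_mat_vec[OF A x(1)] x(3)
    by (simp add: smult_smult_assoc mult.commute)
  have Hv: "H *\<^sub>v v = unit_vec (Suc n) 0"
    using H assoc_mult_mat_vec[OF H(1) H(1), of "unit_vec (Suc n) 0"] by simp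
  define B where "B = H * A * H"
  have B[simp]: "B \<in> carrier_mat (Suc n) (Suc n)" using H A by (simp add: B_def)
  have Bsym: "transpose_mat B = B"
    unfolding B_def using H A sym
    by (simp add: transpose_mult[of _ "Suc n" "Suc n" _ "Suc n"] assoc_mult_mat[of _ "Suc n" "Suc n" _ "Suc n" _ "Suc n"])
  have Bu: "B *\<^sub>v unit_vec (Suc n) 0 = k \<cdot>\<^sub>v unit_vec (Suc n) 0"
  proof -
    have "B *\<^sub>v unit_vec (Suc n) 0 = H *\<^sub>v (A *\<^sub>v (H *\<^sub>v unit_vec (Suc n) 0))"
      unfolding B_def using H(1) A
      by (simp add: assoc_mult_mat_vec[of _ "Suc n" "Suc n" _ "Suc n"])
    also have "\<dots> = k \<cdot>\<^sub>v unit_vec (Suc n) 0"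
      unfolding H(4) Av using mult_mat_vec[OF H(1) v] Hv by simp
    finally show ?thesis .
  qed
  have col0: "B $$ (i, 0) = (if i = 0 then k else 0)" if "i < Suc n" for i
  proof -
    have "(B *\<^sub>v unit_vec (Suc n) 0) $ i = B $$ (i, 0)"
      using that carrier_matD[OF B] by (simp add: mult_mat_vec_def)
    then show ?thesis unfolding Bu using that by auto
  qed
  have symij: "B $$ (i, j) = B $$ (j, i)" if "i < Suc n" "j < Suc n" for i j
    using that B arg_cong[OF Bsym, of "\<lambda>M. M $$ (i, j)"] by (metis index_transpose_mat(1) carrier_matD)
  define A' where "A' = mat n n (\<lambda>(i, j). B $$ (Suc i, Suc j))"
  have A': "A' \<in> carrier_mat n n" "transpose_mat A' = A'"
    by (auto simp: A'_def symij intro!: eq_matI)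
  obtain U' l' where U': "U' \<in> carrier_mat n n" "U' * transpose_mat U' = 1\<^sub>m n"
     "transpose_mat U' * U' = 1\<^sub>m n" and A'eq: "A' = U' * mat_diag n l' * transpose_mat U'"
    using Suc.IH[OF A'] by blast
  have Bblock: "B = four_block_mat (mat_diag 1 (\<lambda>_. k)) (0\<^sub>m 1 n) (0\<^sub>m n 1) A'"
  proof (rule eq_matI)
    fix i j assume "i < dim_row (four_block_mat (mat_diag 1 (\<lambda>_. k)) (0\<^sub>m 1 n) (0\<^sub>m n 1) A')"
      "j < dim_col (four_block_mat (mat_diag 1 (\<lambda>_. k)) (0\<^sub>m 1 n) (0\<^sub>m n 1) A')"
    then have ij: "i < Suc n" "j < Suc n" by (auto simp: mat_diag_def A'_def)
    then show "B $$ (i, j) = four_block_mat (mat_diag 1 (\<lambda>_. k)) (0\<^sub>m 1 n) (0\<^sub>m n 1) A' $$ (i, j)"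
      using col0[OF ij(1)] col0[OF ij(2)] symij[OF ij]
      by (cases i; cases j) (auto simp: mat_diag_def A'_def)
  qed (use carrier_matD[OF B] in \<open>auto simp: mat_diag_def A'_def\<close>)
  define U1 where "U1 = four_block_mat (1\<^sub>m 1) (0\<^sub>m 1 n) (0\<^sub>m n 1) U'"
  define D where "D = mat_diag (Suc n) (case_nat k l')"
  have D: "D = four_block_mat (mat_diag 1 (\<lambda>_. k)) (0\<^sub>m 1 n) (0\<^sub>m n 1) (mat_diag n l')"
    unfolding D_def by (rule eq_matI) (auto simp: mat_diag_def split: nat.splits)
  have Dc[simp]: "D \<in> carrier_mat (Suc n) (Suc n)" unfolding D_def by simp
  have U1c[simp]: "U1 \<in> carrier_mat (Suc n) (Suc n)" unfolding U1_def using U' by auto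
  have U1t: "transpose_mat U1 = four_block_mat (1\<^sub>m 1) (0\<^sub>m 1 n) (0\<^sub>m n 1) (transpose_mat U')"
    unfolding U1_def using U' by (subst transpose_four_block_mat[of _ 1 1 _ n _ n]) auto
  note mb = mult_four_block_mat[of _ 1 1 _ n _ n _ _ 1 _ n]
  have U1U: "U1 * transpose_mat U1 = 1\<^sub>m (Suc n)" "transpose_mat U1 * U1 = 1\<^sub>m (Suc n)"
    unfolding U1t unfolding U1_def using U' by (subst mb; simp)+
  have UD: "U' * mat_diag n l' \<in> carrier_mat n n" "transpose_mat U' \<in> carrier_mat n n" using U' by auto
  note zero_block = left_mult_zero_mat[OF mat_diag_dim] right_mult_zero_mat[OF UD(1)]
    left_mult_zero_mat[OF UD(2)] right_mult_zero_mat[OF mat_diag_dim]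
  have BU: "B = U1 * D * transpose_mat U1"
    unfolding U1t unfolding U1_def D Bblock A'eq using U'
    by (subst mb, simp_all, subst mb, simp_all add: zero_block 
        left_mult_one_mat[OF mat_diag_dim] right_mult_one_mat[OF mat_diag_dim]
        left_add_zero_mat[OF mult_carrier_mat[OF UD]] right_add_zero_mat[OF mat_diag_dim])
  define U where "U = H * U1"
  have U[simp]: "U \<in> carrier_mat (Suc n) (Suc n)" using H by (simp add: U_def)
  have Ut: "transpose_mat U = transpose_mat U1 * H"
    unfolding U_def using H by (simp add: transpose_mult[of _ "Suc n" "Suc n" _ "Suc n"])
  note as = assoc_mult_mat[of _ "Suc n" "Suc n" _ "Suc n" _ "Suc n"] mult_carrier_mat[of _ "Suc n" "Suc n" _ "Suc n"]
  have "U * transpose_mat U = H * (U1 * transpose_mat U1) * H"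
    unfolding Ut unfolding U_def using H(1) by (simp add: as)
  then have 1: "U * transpose_mat U = 1\<^sub>m (Suc n)" using H by (simp add: U1U)
  have "transpose_mat U * U = transpose_mat U1 * (H * H) * U1"
    unfolding Ut unfolding U_def using H(1) by (simp add: as)
  then have 2: "transpose_mat U * U = 1\<^sub>m (Suc n)" using H U1U
    by (simp add: right_mult_one_mat[of _ "Suc n" "Suc n"])
  have "A = (H * H) * A * (H * H)" using H A by simp
  also have "\<dots> = H * B * H" unfolding B_def using H(1) A by (simp add: as)
  also have "\<dots> = U * D * transpose_mat U"
    unfolding BU Ut unfolding U_def using H by (simp add: as)
  finally have "A = U * mat_diag (Suc n) (case_nat k l') * transpose_mat U" unfolding D_def .
  with 1 2 U show ?case by blast
qed

subsection \<open>Orthogonal invariance of product Gaussian measures\<close>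

abbreviation lebesgue_on_index :: "'i set \<Rightarrow> ('i \<Rightarrow> real) measure" where
  "lebesgue_on_index I \<equiv> PiM I (\<lambda>_. lborel)"

interpretation lborel_product: product_sigma_finite "\<lambda>_. lborel :: real measure" ..

text \<open>It suffices to compare boxes, whose preimages are boxes with translated sides.
  Translation invariance is the only geometric property of product Lebesgue measure on which both
  the orthogonal invariance and the almost sure invertibility below rest.\<close>

lemma distr_PiM_lborel_translate:
  fixes c :: "'i \<Rightarrow> real"
  assumes I: "finite I"
  shows "distr (lebesgue_on_index I) (lebesgue_on_index I) (\<lambda>x. \<lambda>i\<in>I. x i + c i) = lebesgue_on_index I"
proof (rule lborel_product.PiM_eqI[OF I])
  fix A :: "'i \<Rightarrow> real set" assume A: "\<And>i. i \<in> I \<Longrightarrow> A i \<in> sets lborel"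
  let ?T = "\<lambda>x. \<lambda>i\<in>I. x i + c i"
  have "?T -` Pi\<^sub>E I A \<inter> space (lebesgue_on_index I) = Pi\<^sub>E I (\<lambda>i. (\<lambda>x. x + c i) -` A i)"
    by (auto simp: space_PiM PiE_iff extensional_def)
  moreover have "emeasure lborel ((\<lambda>x. x + c i) -` A i) = emeasure lborel (A i)" if "i \<in> I" for i
  proof -
    have "emeasure lborel (A i) = emeasure (distr lborel borel ((+) (c i))) (A i)"
      by (simp add: lborel_distr_plus)
    also have "\<dots> = emeasure lborel ((\<lambda>x. x + c i) -` A i)"
      using A[OF that] by (subst emeasure_distr) (auto simp: add.commute[of "c i"] intro!: arg_cong2[where f=emeasure])
    finally show ?thesis by simp
  qed
  moreover have "(\<lambda>x. x + c i) -` A i \<in> sets lborel" if "i \<in> I" for i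
    using measurable_sets[of "\<lambda>x. x + c i" borel borel "A i"] A[OF that] by simp
  ultimately show "emeasure (distr (lebesgue_on_index I) (lebesgue_on_index I) ?T) (Pi\<^sub>E I A)
      = (\<Prod>i\<in>I. emeasure lborel (A i))"
    using A I by (subst emeasure_distr) (auto simp: lborel_product.emeasure_PiM intro!: sets_PiM_I_finite)
qed simp

lemma nn_integral_PiM_lborel_translate:
  assumes "finite I" and [measurable]: "f \<in> borel_measurable (lebesgue_on_index I)"
  shows "(\<integral>\<^sup>+x. f (\<lambda>i\<in>I. x i + c i) \<partial>lebesgue_on_index I) = (\<integral>\<^sup>+x. f x \<partial>lebesgue_on_index I)"
  by (subst (2) distr_PiM_lborel_translate[OF assms(1), of c, symmetric], subst nn_integral_distr) auto

lemma nn_integral_normal_density: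
  "\<sigma> > 0 \<Longrightarrow> (\<integral>\<^sup>+x. ennreal (normal_density \<mu> \<sigma> x) \<partial>lborel) = 1"
  by (simp add: nn_integral_eq_integral)

text \<open>The product density depends only on the number of coordinates and on the squared norm,
  so an orthogonal map between index sets of equal size preserves it.\<close>

lemma prod_normal_density:
  assumes "finite I"
  shows "(\<Prod>i\<in>I. normal_density 0 \<sigma> (x i))
    = (1 / sqrt (2 * pi * \<sigma>\<^sup>2)) ^ card I * exp (- (\<Sum>i\<in>I. (x i)\<^sup>2) / (2 * \<sigma>\<^sup>2))"
  using assms
  by (simp add: normal_density_def prod.distrib exp_sum[symmetric] sum_negf sum_divide_distrib power_divide
      prod_dividef)

lemma sum_squares_orthonormal_columns:
  fixes a :: "'j \<Rightarrow> 'i \<Rightarrow> real"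
  assumes I: "finite I"
    and cols: "\<And>i i'. i \<in> I \<Longrightarrow> i' \<in> I \<Longrightarrow> (\<Sum>j\<in>J. a j i * a j i') = (if i = i' then 1 else 0)"
  shows "(\<Sum>j\<in>J. (\<Sum>i\<in>I. a j i * x i)\<^sup>2) = (\<Sum>i\<in>I. (x i)\<^sup>2)"
proof -
  have "(\<Sum>j\<in>J. (\<Sum>i\<in>I. a j i * x i)\<^sup>2) = (\<Sum>j\<in>J. \<Sum>i\<in>I. \<Sum>i'\<in>I. x i * x i' * (a j i * a j i'))"
    by (simp add: power2_eq_square sum_product mult_ac)
  also have "\<dots> = (\<Sum>i\<in>I. \<Sum>i'\<in>I. \<Sum>j\<in>J. x i * x i' * (a j i * a j i'))"
    by (subst sum.swap, intro sum.cong refl, rule sum.swap)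
  also have "\<dots> = (\<Sum>i\<in>I. \<Sum>i'\<in>I. if i = i' then x i * x i' else 0)"
    by (intro sum.cong refl) (simp add: sum_distrib_left[symmetric] cols)
  also have "\<dots> = (\<Sum>i\<in>I. (x i)\<^sup>2)" using I by (simp add: power2_eq_square)
  finally show ?thesis .
qed

text \<open>The normalizing constant is found by Fubini instead of a determinant: for all nonnegative f, g,
  translation invariance gives
  \<open>\<integral> f (T x) dx * \<integral> g y dy = \<integral> f y dy * \<integral> g (- T x) dx\<close>, and a Gaussian g makes both g-integrals
  equal to 1.\<close>

lemma nn_integral_PiM_lborel_orthogonal:
  fixes a :: "'j \<Rightarrow> 'i \<Rightarrow> real"
  assumes I: "finite I" and J: "finite J" and card: "card I = card J"
    and rows: "\<And>j j'. j \<in> J \<Longrightarrow> j' \<in> J \<Longrightarrow> (\<Sum>i\<in>I. a j i * a j' i) = (if j = j' then 1 else 0)"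
    and cols: "\<And>i i'. i \<in> I \<Longrightarrow> i' \<in> I \<Longrightarrow> (\<Sum>j\<in>J. a j i * a j i') = (if i = i' then 1 else 0)"
    and f[measurable]: "f \<in> borel_measurable (lebesgue_on_index J)"
  shows "(\<integral>\<^sup>+x. f (\<lambda>j\<in>J. \<Sum>i\<in>I. a j i * x i) \<partial>lebesgue_on_index I) = (\<integral>\<^sup>+y. f y \<partial>lebesgue_on_index J)"
proof -
  let ?L = "lebesgue_on_index I" and ?M = "lebesgue_on_index J"
  let ?T = "\<lambda>x. \<lambda>j\<in>J. \<Sum>i\<in>I. a j i * x i"
  let ?t = "\<lambda>x j. \<Sum>i\<in>I. a j i * x i"
  let ?S = "\<lambda>y i. \<Sum>j\<in>J. a j i * y j"
  define g where "g = (\<lambda>y :: 'j \<Rightarrow> real. \<Prod>j\<in>J. ennreal (normal_density 0 1 (y j)))"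
  interpret L: finite_product_sigma_finite "\<lambda>_. lborel :: real measure" I by standard fact
  interpret M: finite_product_sigma_finite "\<lambda>_. lborel :: real measure" J by standard fact
  interpret LM: pair_sigma_finite ?L ?M ..
  have [measurable]: "?T \<in> ?L \<rightarrow>\<^sub>M ?M" by measurable
  have [measurable]: "g \<in> borel_measurable ?M" unfolding g_def by measurable
  have g1: "(\<integral>\<^sup>+y. g y \<partial>?M) = 1"
    unfolding g_def
    using lborel_product.product_nn_integral_prod[OF J, of "\<lambda>_ x. ennreal (normal_density 0 1 x)"]
    by (simp add: nn_integral_normal_density)
  \<comment> \<open>Orthonormal rows make the transpose \<open>?S\<close> a right inverse of T, so
    translating x by \<open>?S y\<close> translates T x by y.\<close>
  have TS: "(\<Sum>i\<in>I. a j i * (x i + ?S y i)) = (\<Sum>i\<in>I. a j i * x i) + y j" if "j \<in> J" for x y j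
  proof -
    have "(\<Sum>i\<in>I. a j i * ?S y i) = (\<Sum>j'\<in>J. \<Sum>i\<in>I. a j i * (a j' i * y j'))"
      unfolding sum_distrib_left by (rule sum.swap)
    also have "\<dots> = (\<Sum>j'\<in>J. (if j = j' then y j' else 0))"
      using rows[OF that] by (intro sum.cong refl) (simp add: mult.assoc[symmetric] sum_distrib_right[symmetric])
    also have "\<dots> = y j" using that J by simp
    finally show ?thesis by (simp add: distrib_left sum.distrib)
  qed
  have TS': "(\<Sum>i\<in>I. a j i * (\<lambda>i\<in>I. x i + ?S y i) i) = ?t x j + y j" if "j \<in> J" for x y j
    using TS[OF that, of x y] by simp
  have shift: "?T (\<lambda>i\<in>I. x i + ?S y i) = (\<lambda>j\<in>J. ?t x j + y j)" for x y
    by (auto simp: fun_eq_iff restrict_def TS[symmetric] intro!: sum.cong)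
  \<comment> \<open>Orthonormal columns make T an isometry, so the Gaussian density at - T x is the
    Gaussian density at x.\<close>
  have gT: "(\<integral>\<^sup>+x. g (\<lambda>j\<in>J. - ?t x j) \<partial>?L) = 1"
  proof -
    have "g (\<lambda>j\<in>J. - ?t x j) = (\<Prod>i\<in>I. ennreal (normal_density 0 1 (x i)))" for x
      using sum_squares_orthonormal_columns[OF I cols, of x] card
      by (simp add: g_def prod_ennreal prod_normal_density I J)
    then show ?thesis
      using lborel_product.product_nn_integral_prod[OF I, of "\<lambda>_ x. ennreal (normal_density 0 1 x)"]
      by (simp add: nn_integral_normal_density)
  qed
  have "(\<integral>\<^sup>+x. f (?T x) \<partial>?L) = (\<integral>\<^sup>+y. g y * (\<integral>\<^sup>+x. f (?T x) \<partial>?L) \<partial>?M)"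
    by (subst nn_integral_multc) (simp_all add: g1)
  also have "\<dots> = (\<integral>\<^sup>+y. g y * (\<integral>\<^sup>+x. f (?T (\<lambda>i\<in>I. x i + ?S y i)) \<partial>?L) \<partial>?M)"
    by (subst nn_integral_PiM_lborel_translate[OF I, of "\<lambda>x. f (?T x)"]) simp_all
  also have "\<dots> = (\<integral>\<^sup>+y. (\<integral>\<^sup>+x. g y * f (\<lambda>j\<in>J. y j + ?t x j) \<partial>?L) \<partial>?M)"
    unfolding shift by (intro nn_integral_cong, subst nn_integral_cmult) (simp_all add: add.commute cong: restrict_cong)
  also have "\<dots> = (\<integral>\<^sup>+x. (\<integral>\<^sup>+y. g y * f (\<lambda>j\<in>J. y j + ?t x j) \<partial>?M) \<partial>?L)"
    by (rule LM.Fubini') measurable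
  \<comment> \<open>For fixed x, the variable y is translated by T x.\<close>
  also have "\<dots> = (\<integral>\<^sup>+x. (\<integral>\<^sup>+y. g (\<lambda>j\<in>J. y j - ?t x j) * f y \<partial>?M) \<partial>?L)"
  proof (rule nn_integral_cong)
    fix x
    have "(\<integral>\<^sup>+y. g y * f (\<lambda>j\<in>J. y j + ?t x j) \<partial>?M)
      = (\<integral>\<^sup>+y. g (\<lambda>j\<in>J. (\<lambda>j\<in>J. y j + ?t x j) j - ?t x j) * f (\<lambda>j\<in>J. y j + ?t x j) \<partial>?M)"
      by (simp add: g_def)
    also have "\<dots> = (\<integral>\<^sup>+y. g (\<lambda>j\<in>J. y j - ?t x j) * f y \<partial>?M)"
      by (rule nn_integral_PiM_lborel_translate[OF J, of "\<lambda>y. g (\<lambda>j\<in>J. y j - ?t x j) * f y"]) measurable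
    finally show "(\<integral>\<^sup>+y. g y * f (\<lambda>j\<in>J. y j + ?t x j) \<partial>?M) = (\<integral>\<^sup>+y. g (\<lambda>j\<in>J. y j - ?t x j) * f y \<partial>?M)" .
  qed
  also have "\<dots> = (\<integral>\<^sup>+y. (\<integral>\<^sup>+x. g (\<lambda>j\<in>J. y j - ?t x j) * f y \<partial>?L) \<partial>?M)"
    by (rule LM.Fubini'[symmetric]) measurable
  also have "\<dots> = (\<integral>\<^sup>+y. (\<integral>\<^sup>+x. g (\<lambda>j\<in>J. y j - ?t x j) \<partial>?L) * f y \<partial>?M)"
    by (intro nn_integral_cong nn_integral_multc) measurable
  \<comment> \<open>Translating x by \<open>?S y\<close> cancels y in the argument of g, so the
    inner integral becomes a constant.\<close>
  also have "\<dots> = (\<integral>\<^sup>+y. (\<integral>\<^sup>+x. g (\<lambda>j\<in>J. y j - ?t (\<lambda>i\<in>I. x i + ?S y i) j) \<partial>?L) * f y \<partial>?M)"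
    by (intro nn_integral_cong arg_cong2[where f="(*)"] refl
        nn_integral_PiM_lborel_translate[OF I, of "\<lambda>x. g (\<lambda>j\<in>J. _ j - ?t x j)", symmetric]) measurable
  also have "\<dots> = (\<integral>\<^sup>+y. (\<integral>\<^sup>+x. g (\<lambda>j\<in>J. - ?t x j) \<partial>?L) * f y \<partial>?M)"
  proof (intro nn_integral_cong arg_cong2[where f="(*)"] refl arg_cong[where f=g] restrict_ext)
    fix y x j assume "j \<in> J"
    then show "y j - ?t (\<lambda>i\<in>I. x i + ?S y i) j = - ?t x j" using TS'[of j x y] by linarith
  qed
  also have "\<dots> = (\<integral>\<^sup>+y. f y \<partial>?M)" unfolding gT by simp
  finally show ?thesis .
qed

text \<open>On a box the indicator factors over the coordinates, so both measures give the same
  product. This form carries statements about product Lebesgue measure over to Gaussian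
  vectors.\<close>

lemma PiM_normal_density:
  assumes I: "finite I" and \<sigma>: "\<sigma> > 0"
  shows "PiM I (\<lambda>_. density lborel (normal_density 0 \<sigma>))
    = density (lebesgue_on_index I) (\<lambda>x. \<Prod>i\<in>I. ennreal (normal_density 0 \<sigma> (x i)))"
proof -
  let ?N = "density lborel (normal_density 0 \<sigma>) :: real measure"
  interpret N: prob_space ?N using \<sigma> by (rule prob_space_normal_density)
  interpret PN: product_sigma_finite "\<lambda>_. ?N" ..
  have s: "sets (PiM I (\<lambda>_. ?N)) = sets (lebesgue_on_index I)"
    by (rule sets_PiM_cong) auto
  show ?thesis
  proof (rule PN.PiM_eqI[OF I, symmetric])
    fix A :: "'a \<Rightarrow> real set" assume A: "\<And>i. i \<in> I \<Longrightarrow> A i \<in> sets ?N"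
    then have A': "\<And>i. i \<in> I \<Longrightarrow> A i \<in> sets borel" by simp
    have "emeasure (density (lebesgue_on_index I) (\<lambda>x. \<Prod>i\<in>I. ennreal (normal_density 0 \<sigma> (x i)))) (Pi\<^sub>E I A)
      = (\<integral>\<^sup>+x. (\<Prod>i\<in>I. ennreal (normal_density 0 \<sigma> (x i))) * indicator (Pi\<^sub>E I A) x \<partial>lebesgue_on_index I)"
      using A' I by (subst emeasure_density) (auto intro!: sets_PiM_I_finite)
    also have "\<dots> = (\<integral>\<^sup>+x. (\<Prod>i\<in>I. ennreal (normal_density 0 \<sigma> (x i)) * indicator (A i) (x i)) \<partial>lebesgue_on_index I)"
    proof (rule nn_integral_cong)
      fix x :: "'a \<Rightarrow> real" assume "x \<in> space (lebesgue_on_index I)"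
      then have "indicator (Pi\<^sub>E I A) x = (\<Prod>i\<in>I. indicator (A i) (x i) :: ennreal)"
        using I by (auto simp: space_PiM PiE_iff indicator_def prod_zero_iff)
      then show "(\<Prod>i\<in>I. ennreal (normal_density 0 \<sigma> (x i))) * indicator (Pi\<^sub>E I A) x
        = (\<Prod>i\<in>I. ennreal (normal_density 0 \<sigma> (x i)) * indicator (A i) (x i))"
        by (simp add: prod.distrib)
    qed
    also have "\<dots> = (\<Prod>i\<in>I. \<integral>\<^sup>+x. ennreal (normal_density 0 \<sigma> x) * indicator (A i) x \<partial>lborel)"
      using A' by (intro lborel_product.product_nn_integral_prod[OF I]) auto
    also have "\<dots> = (\<Prod>i\<in>I. emeasure ?N (A i))"
      using A' by (intro prod.cong refl) (simp add: emeasure_density)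
    finally show "emeasure (density (lebesgue_on_index I) (\<lambda>x. \<Prod>i\<in>I. ennreal (normal_density 0 \<sigma> (x i)))) (Pi\<^sub>E I A)
       = (\<Prod>i\<in>I. emeasure ?N (A i))" .
  qed (simp add: s)
qed

text \<open>The density is constant along the map and Lebesgue measure is invariant under it. I and
  J are kept apart because the square matrix built next has columns indexed by
  \<open>I <+> K\<close> and rows indexed by \<open>K <+> I\<close>.\<close>

lemma distr_gauss_orthogonal:
  fixes a :: "'j \<Rightarrow> 'i \<Rightarrow> real"
  assumes I: "finite I" and J: "finite J" and card: "card I = card J" and \<sigma>: "\<sigma> > 0"
    and rows: "\<And>j j'. j \<in> J \<Longrightarrow> j' \<in> J \<Longrightarrow> (\<Sum>i\<in>I. a j i * a j' i) = (if j = j' then 1 else 0)"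
    and cols: "\<And>i i'. i \<in> I \<Longrightarrow> i' \<in> I \<Longrightarrow> (\<Sum>j\<in>J. a j i * a j i') = (if i = i' then 1 else 0)"
  defines "N \<equiv> density lborel (normal_density 0 \<sigma>)"
  shows "distr (PiM I (\<lambda>_. N)) (PiM J (\<lambda>_. N)) (\<lambda>x. \<lambda>j\<in>J. \<Sum>i\<in>I. a j i * x i) = PiM J (\<lambda>_. N)"
proof (rule measure_eqI)
  let ?T = "\<lambda>x. \<lambda>j\<in>J. \<Sum>i\<in>I. a j i * x i"
  have sN[measurable_cong]: "sets N = sets borel" by (simp add: N_def)
  have sN': "sets (PiM K (\<lambda>_. N)) = sets (lebesgue_on_index K)" for K
    by (rule sets_PiM_cong) (auto simp: N_def)
  fix A assume "A \<in> sets (distr (PiM I (\<lambda>_. N)) (PiM J (\<lambda>_. N)) ?T)"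
  then have A: "A \<in> sets (PiM J (\<lambda>_. N))" and A'[measurable]: "A \<in> sets (lebesgue_on_index J)"
    by (simp_all add: sN')
  let ?p = "\<lambda>K x. \<Prod>i\<in>K. ennreal (normal_density 0 \<sigma> (x i))"
  have T: "?T \<in> PiM I (\<lambda>_. N) \<rightarrow>\<^sub>M PiM J (\<lambda>_. N)" by measurable
  have [measurable]: "?T \<in> lebesgue_on_index I \<rightarrow>\<^sub>M lebesgue_on_index J" by measurable
  have p: "?p I x = ?p J (?T x)" for x
    using sum_squares_orthonormal_columns[OF I cols, of x] card \<sigma>
    by (simp add: prod_ennreal prod_normal_density I J)
  have "emeasure (distr (PiM I (\<lambda>_. N)) (PiM J (\<lambda>_. N)) ?T) A
      = (\<integral>\<^sup>+x. indicator A (?T x) \<partial>PiM I (\<lambda>_. N))"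
    using A T by (subst nn_integral_indicator[symmetric], simp, subst nn_integral_distr) auto
  also have "\<dots> = (\<integral>\<^sup>+x. ?p I x * indicator A (?T x) \<partial>lebesgue_on_index I)"
    unfolding N_def PiM_normal_density[OF I \<sigma>] by (subst nn_integral_density) auto
  also have "\<dots> = (\<integral>\<^sup>+x. ?p J (?T x) * indicator A (?T x) \<partial>lebesgue_on_index I)"
    unfolding p ..
  also have "\<dots> = (\<integral>\<^sup>+y. ?p J y * indicator A y \<partial>lebesgue_on_index J)"
    using nn_integral_PiM_lborel_orthogonal[OF I J card rows cols, of "\<lambda>y. ?p J y * indicator A y"]
    by simp
  also have "\<dots> = emeasure (PiM J (\<lambda>_. N)) A"
    unfolding N_def PiM_normal_density[OF J \<sigma>] by (subst emeasure_density) auto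
  finally show "emeasure (distr (PiM I (\<lambda>_. N)) (PiM J (\<lambda>_. N)) ?T) A = emeasure (PiM J (\<lambda>_. N)) A" .
qed simp

text \<open>A matrix A with orthonormal rows need not be square; it is completed to the orthogonal block
  matrix with rows (A, 0) and (1 - A^T A, A^T).\<close>

theorem distr_gauss_orthonormal_rows:
  fixes a :: "'k \<Rightarrow> 'i \<Rightarrow> real"
  assumes I: "finite I" and K: "finite K" and \<sigma>: "\<sigma> > 0"
    and rows: "\<And>j j'. j \<in> K \<Longrightarrow> j' \<in> K \<Longrightarrow> (\<Sum>i\<in>I. a j i * a j' i) = (if j = j' then 1 else 0)"
  defines "N \<equiv> density lborel (normal_density 0 \<sigma>)"
  shows "distr (PiM I (\<lambda>_. N)) (PiM K (\<lambda>_. N)) (\<lambda>x. \<lambda>k\<in>K. \<Sum>i\<in>I. a k i * x i) = PiM K (\<lambda>_. N)"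
proof -
  have sN[measurable_cong]: "sets N = sets borel" by (simp add: N_def)
  interpret N: prob_space N using \<sigma> unfolding N_def by (rule prob_space_normal_density)
  interpret P1: product_prob_space "\<lambda>_ :: 'i + 'k. N" "I <+> K" ..
  interpret P2: product_prob_space "\<lambda>_ :: 'k + 'i. N" "K <+> I" ..
  let ?\<delta> = "\<lambda>i i'. if i = i' then 1 else (0::real)"
  \<comment> \<open>Q = 1 - P with P = A^T A is the orthogonal projection onto the complement of the
    row space of A. The facts \<open>kP\<close> and \<open>PP\<close> below say A P = A and P P =
    P.\<close>
  define Q where "Q = (\<lambda>i i'. ?\<delta> i i' - (\<Sum>k\<in>K. a k i * a k i'))"
  define b where "b = (\<lambda>s t. case s of
      Inl k \<Rightarrow> (case t of Inl i \<Rightarrow> a k i | Inr k' \<Rightarrow> 0)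
    | Inr i \<Rightarrow> (case t of Inl i' \<Rightarrow> Q i i' | Inr k \<Rightarrow> a k i))"
  have sumL: "(\<Sum>t\<in>I <+> K. h t) = (\<Sum>i\<in>I. h (Inl i)) + (\<Sum>k\<in>K. h (Inr k))" for h :: "_ \<Rightarrow> real"
    using I K by (subst sum.Plus) auto
  have sumR: "(\<Sum>t\<in>K <+> I. h t) = (\<Sum>i\<in>K. h (Inl i)) + (\<Sum>k\<in>I. h (Inr k))" for h :: "_ \<Rightarrow> real"
    using I K by (subst sum.Plus) auto
  have kP: "(\<Sum>i'\<in>I. a k i' * (\<Sum>k'\<in>K. a k' i * a k' i')) = a k i" if "k \<in> K" for k i
  proof -
    have "(\<Sum>i'\<in>I. a k i' * (\<Sum>k'\<in>K. a k' i * a k' i')) = (\<Sum>k'\<in>K. \<Sum>i'\<in>I. a k i' * (a k' i * a k' i'))"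
      unfolding sum_distrib_left by (rule sum.swap)
    also have "\<dots> = (\<Sum>k'\<in>K. a k' i * (\<Sum>i'\<in>I. a k i' * a k' i'))"
      by (simp add: sum_distrib_left mult_ac)
    also have "\<dots> = (\<Sum>k'\<in>K. if k = k' then a k' i else 0)"
      using rows[OF that] by (intro sum.cong) auto
    finally show ?thesis using that K by simp
  qed
  have PP: "(\<Sum>i\<in>I. (\<Sum>k\<in>K. a k p * a k i) * (\<Sum>k\<in>K. a k q * a k i)) = (\<Sum>k\<in>K. a k p * a k q)" for p q
  proof -
    have "(\<Sum>i\<in>I. (\<Sum>k\<in>K. a k p * a k i) * (\<Sum>k\<in>K. a k q * a k i))
      = (\<Sum>k\<in>K. \<Sum>i\<in>I. a k p * (a k i * (\<Sum>k\<in>K. a k q * a k i)))"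
      unfolding sum_distrib_right by (subst sum.swap) (simp add: mult_ac)
    also have "\<dots> = (\<Sum>k\<in>K. a k p * a k q)"
      by (simp add: sum_distrib_left[symmetric] kP)
    finally show ?thesis .
  qed
  have Qsym: "Q i i' = Q i' i" for i i'
    by (auto simp: Q_def mult.commute)
  have aQ: "(\<Sum>i'\<in>I. a k i' * Q i i') = 0" if "k \<in> K" "i \<in> I" for k i
    using kP[OF that(1), of i] that I
    by (simp add: Q_def right_diff_distrib sum_subtractf if_distrib[of "\<lambda>x. _ * x"] cong: if_cong)
  have QQ: "(\<Sum>i\<in>I. Q p i * Q q i) + (\<Sum>k\<in>K. a k p * a k q) = ?\<delta> p q" if "p \<in> I" "q \<in> I" for p q
  proof -
    have "(\<Sum>i\<in>I. Q p i * Q q i)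
      = (\<Sum>i\<in>I. (if p = i then ?\<delta> q i else 0) - (if p = i then (\<Sum>k\<in>K. a k q * a k i) else 0)
          - (if q = i then (\<Sum>k\<in>K. a k p * a k i) else 0)
          + (\<Sum>k\<in>K. a k p * a k i) * (\<Sum>k\<in>K. a k q * a k i))"
      unfolding Q_def by (intro sum.cong refl) (auto simp: algebra_simps)
    also have "\<dots> = ?\<delta> q p - (\<Sum>k\<in>K. a k q * a k p) - (\<Sum>k\<in>K. a k p * a k q) + (\<Sum>k\<in>K. a k p * a k q)"
      using that I by (simp add: sum.distrib sum_subtractf PP)
    finally show ?thesis by (simp add: mult.commute)
  qed
  have orth: "(\<Sum>t\<in>I <+> K. b s t * b s' t) = (if s = s' then 1 else 0)" if "s \<in> K <+> I" "s' \<in> K <+> I" for s s'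
    using that unfolding sumL
    by (auto simp: b_def rows aQ QQ mult.commute[of "Q _ _" "a _ _"] split: if_splits)
  have orth': "(\<Sum>s\<in>K <+> I. b s t * b s t') = (if t = t' then 1 else 0)" if "t \<in> I <+> K" "t' \<in> I <+> K" for t t'
  proof -
    have "(\<Sum>i'\<in>I. a k i' * Q i' i) = 0" if "k \<in> K" "i \<in> I" for k i
      using aQ[OF that] by (simp add: Qsym)
    moreover have "(\<Sum>k\<in>K. a k p * a k q) + (\<Sum>i\<in>I. Q i p * Q i q) = ?\<delta> p q" if "p \<in> I" "q \<in> I" for p q
      using QQ[OF that] by (simp add: Qsym[of _ p] Qsym[of _ q] add.commute)
    ultimately show ?thesis
      using that unfolding sumR by (auto simp: b_def rows mult.commute[of "Q _ _" "a _ _"] split: if_splits)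
  qed
  let ?T = "\<lambda>x. \<lambda>s\<in>K <+> I. \<Sum>t\<in>I <+> K. b s t * x t"
  let ?A = "\<lambda>x. \<lambda>k\<in>K. \<Sum>i\<in>I. a k i * x i"
  have [measurable]: "?T \<in> PiM (I <+> K) (\<lambda>_. N) \<rightarrow>\<^sub>M PiM (K <+> I) (\<lambda>_. N)"
    by measurable
  \<comment> \<open>The \<open>Inl\<close> coordinates of a Gaussian vector on
    \<open>K <+> I\<close> form a Gaussian vector on K. Once that vector is written as the image
    under b, the zero block shows that these coordinates depend only on the \<open>Inl\<close>
    coordinates of the input, through A.\<close>
  have "PiM K (\<lambda>_. N) = distr (PiM (K <+> I) (\<lambda>_. N)) (PiM K (\<lambda>_. N)) (\<lambda>y. \<lambda>k\<in>K. y (Inl k))"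
    using I K by (intro P2.distr_reorder[symmetric]) auto
  also have "\<dots> = distr (distr (PiM (I <+> K) (\<lambda>_. N)) (PiM (K <+> I) (\<lambda>_. N)) ?T) (PiM K (\<lambda>_. N)) (\<lambda>y. \<lambda>k\<in>K. y (Inl k))"
    using distr_gauss_orthogonal[of "I <+> K" "K <+> I" \<sigma> b] I K \<sigma> orth orth'
    by (simp add: N_def card_Plus add.commute)
  also have "\<dots> = distr (PiM (I <+> K) (\<lambda>_. N)) (PiM K (\<lambda>_. N)) (\<lambda>x. ?A (\<lambda>i\<in>I. x (Inl i)))"
  proof (subst distr_distr)
    show "(\<lambda>y. \<lambda>k\<in>K. y (Inl k)) \<in> PiM (K <+> I) (\<lambda>_. N) \<rightarrow>\<^sub>M PiM K (\<lambda>_. N)"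
      by (intro measurable_restrict measurable_component_singleton) auto
    show "?T \<in> PiM (I <+> K) (\<lambda>_. N) \<rightarrow>\<^sub>M PiM (K <+> I) (\<lambda>_. N)" by measurable
  qed (auto simp: comp_def sumL b_def InlI intro!: distr_cong cong: restrict_cong)
  also have "\<dots> = distr (distr (PiM (I <+> K) (\<lambda>_. N)) (PiM I (\<lambda>_. N)) (\<lambda>x. \<lambda>i\<in>I. x (Inl i))) (PiM K (\<lambda>_. N)) ?A"
    by (subst distr_distr) (auto simp: comp_def intro!: measurable_restrict measurable_component_singleton)
  also have "distr (PiM (I <+> K) (\<lambda>_. N)) (PiM I (\<lambda>_. N)) (\<lambda>x. \<lambda>i\<in>I. x (Inl i)) = PiM I (\<lambda>_. N)"
    using I K by (intro P1.distr_reorder) auto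
  finally show ?thesis by (simp add: restrict_def)
qed

subsection \<open>Singular value decomposition and the polar factor\<close>

text \<open>A thin decomposition: E consists of d orthonormal rows, and strict positivity of s
  encodes full row rank. The values s need not be ordered. The product U E is the polar
  factor.\<close>

definition svd :: "nat \<Rightarrow> nat \<Rightarrow> real mat \<Rightarrow> real mat \<Rightarrow> (nat \<Rightarrow> real) \<Rightarrow> real mat \<Rightarrow> bool" where
  "svd d r Y U s E \<longleftrightarrow> U \<in> carrier_mat d d \<and> U * transpose_mat U = 1\<^sub>m d \<and> transpose_mat U * U = 1\<^sub>m d
     \<and> (\<forall>k<d. 0 < s k) \<and> E \<in> stiefel d r \<and> Y = U * mat_diag d s * E"

lemma svdD:
  assumes "svd d r Y U s E"
  shows "U \<in> carrier_mat d d" "U * transpose_mat U = 1\<^sub>m d" "transpose_mat U * U = 1\<^sub>m d"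
    "\<And>k. k < d \<Longrightarrow> 0 < s k" "E \<in> carrier_mat d r" "E * transpose_mat E = 1\<^sub>m d"
    "Y = U * mat_diag d s * E" "Y \<in> carrier_mat d r"
  using assms by (auto simp: svd_def stiefel_def)

lemma mat_diag_cong: "(\<And>i. i < n \<Longrightarrow> f i = g i) \<Longrightarrow> mat_diag n f = mat_diag n g"
  by (rule eq_matI) (auto simp: mat_diag_def)

lemma det_zero_row:
  fixes M :: "'a :: comm_ring_1 mat"
  assumes M: "M \<in> carrier_mat n n" and k: "k < n" and z: "\<And>j. j < n \<Longrightarrow> M $$ (k, j) = 0"
  shows "det M = 0"
proof -
  have "M = mat\<^sub>r n n (\<lambda>i. if i = k then 0\<^sub>v n else row M i)"
    using M z by (intro eq_matI) auto
  then show ?thesis by (rule ssubst) (rule det_row_0[OF k], use M in auto)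
qed

text \<open>In the eigenbasis of the Gram matrix the rows of U^T Y are orthogonal with squared
  lengths l. The last conclusion records this, which makes l nonnegative and turns a zero eigenvalue
  into a zero row.\<close>

lemma gram_spectral:
  fixes Y :: "real mat"
  assumes Y: "Y \<in> carrier_mat d r"
  obtains U l where "U \<in> carrier_mat d d" "U * transpose_mat U = 1\<^sub>m d" "transpose_mat U * U = 1\<^sub>m d"
    "Y * transpose_mat Y = U * mat_diag d l * transpose_mat U"
    "transpose_mat U * Y * transpose_mat (transpose_mat U * Y) = mat_diag d l"
    "\<And>k. k < d \<Longrightarrow> l k = (\<Sum>j<r. ((transpose_mat U * Y) $$ (k, j))\<^sup>2)"
proof -
  let ?A = "Y * transpose_mat Y"
  have A: "?A \<in> carrier_mat d d" "transpose_mat ?A = ?A"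
    using Y by (auto simp: transpose_mult[OF Y])
  obtain U l where U: "U \<in> carrier_mat d d" "U * transpose_mat U = 1\<^sub>m d" "transpose_mat U * U = 1\<^sub>m d"
     and AU: "?A = U * mat_diag d l * transpose_mat U"
    using symmetric_spectral[OF A] by blast
  define W where "W = transpose_mat U * Y"
  have W[simp]: "W \<in> carrier_mat d r" using U Y by (simp add: W_def)
  have Wt: "transpose_mat W = transpose_mat Y * U"
    unfolding W_def using U Y by (simp add: transpose_mult[of _ d d _ r])
  have WW: "W * transpose_mat W = mat_diag d l"
  proof -
    have "W * transpose_mat W = transpose_mat U * ?A * U"
      unfolding Wt unfolding W_def using U(1) Y
        assoc_mult_mat[of "transpose_mat U" d d Y r "transpose_mat Y * U" d]
        assoc_mult_mat[of Y d r "transpose_mat Y" d U d]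
        assoc_mult_mat[of "transpose_mat U" d d "Y * transpose_mat Y" d U d] by simp
    also have "\<dots> = (transpose_mat U * U) * mat_diag d l * (transpose_mat U * U)"
      unfolding AU using U(1)
      by (simp add: assoc_mult_mat[of _ d d _ d _ d] mult_carrier_mat[of _ d d _ d])
    also have "\<dots> = mat_diag d l" unfolding U(3)
      by (simp add: left_mult_one_mat[OF mat_diag_dim] right_mult_one_mat[OF mat_diag_dim])
    finally show ?thesis .
  qed
  have l: "l k = (\<Sum>j<r. (W $$ (k, j))\<^sup>2)" if "k < d" for k
  proof -
    have "l k = (W * transpose_mat W) $$ (k, k)" unfolding WW using that by (simp add: mat_diag_def)
    also have "\<dots> = (\<Sum>j<r. W $$ (k, j) * transpose_mat W $$ (j, k))"
      using that by (intro index_mult_mat_sum) auto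
    also have "\<dots> = (\<Sum>j<r. (W $$ (k, j))\<^sup>2)"
      using that carrier_matD[OF W] by (intro sum.cong) (auto simp: power2_eq_square)
    finally show ?thesis .
  qed
  show ?thesis using that[OF U AU WW[unfolded W_def] l[unfolded W_def]] .
qed

text \<open>E is obtained by normalizing the orthogonal rows of U^T Y. A row of length zero would
  also be a zero row of U^T times the leading square block of Y, contradicting the determinant
  condition. Full rank is tested on this one minor because it is a polynomial that is easy to
  control almost surely.\<close>

lemma svd_exists:
  assumes Y: "Y \<in> carrier_mat d r" and dr: "d \<le> r"
    and det: "det (mat d d (\<lambda>(i, j). Y $$ (i, j))) \<noteq> 0"
  shows "\<exists>U s E. svd d r Y U s E"
proof -
  let ?Y' = "mat d d (\<lambda>(i, j). Y $$ (i, j))"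
  obtain U l where U: "U \<in> carrier_mat d d" "U * transpose_mat U = 1\<^sub>m d" "transpose_mat U * U = 1\<^sub>m d"
     and WW': "transpose_mat U * Y * transpose_mat (transpose_mat U * Y) = mat_diag d l"
     and l': "\<And>k. k < d \<Longrightarrow> l k = (\<Sum>j<r. ((transpose_mat U * Y) $$ (k, j))\<^sup>2)"
    using gram_spectral[OF Y] by metis
  define W where "W = transpose_mat U * Y"
  have W[simp]: "W \<in> carrier_mat d r" using U Y by (simp add: W_def)
  note WW = WW'[folded W_def] and l = l'[folded W_def]
  have pos: "l k > 0" if k: "k < d" for k
  proof (rule ccontr)
    assume "\<not> l k > 0"
    then have "(\<Sum>j<r. (W $$ (k, j))\<^sup>2) = 0"
      unfolding l[OF k] by (meson sum_nonneg zero_le_power2 order.antisym not_less)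
    then have Wz: "W $$ (k, j) = 0" if "j < r" for j
      using that by (subst (asm) sum_nonneg_eq_0_iff) auto
    have U': "transpose_mat U \<in> carrier_mat d d" using U by simp
    have Y': "?Y' \<in> carrier_mat d d" by simp
    have "det (transpose_mat U * ?Y') = 0"
    proof (rule det_zero_row[OF _ k])
      fix j assume j: "j < d"
      have "(transpose_mat U * ?Y') $$ (k, j) = (\<Sum>i<d. transpose_mat U $$ (k, i) * ?Y' $$ (i, j))"
        using k j by (intro index_mult_mat_sum[OF U' Y'])
      also have "\<dots> = (\<Sum>i<d. transpose_mat U $$ (k, i) * Y $$ (i, j))"
        using j by (intro sum.cong) auto
      also have "\<dots> = W $$ (k, j)" unfolding W_def
        using k j dr by (intro index_mult_mat_sum[OF U' Y, symmetric]) auto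
      finally show "(transpose_mat U * ?Y') $$ (k, j) = 0" using Wz[of j] j dr by simp
    qed (use U in simp)
    then have "det (transpose_mat U) * det ?Y' = 0"
      using det_mult[OF U' Y'] by simp
    moreover have "det (transpose_mat U) * det U = 1"
      using det_mult[OF U' U(1)] U(3) by simp
    ultimately show False using det by auto
  qed
  define s where "s = (\<lambda>k. sqrt (l k))"
  define E where "E = mat_diag d (\<lambda>k. 1 / s k) * W"
  have s: "k < d \<Longrightarrow> s k > 0" "k < d \<Longrightarrow> s k * s k = l k" for k
    using pos[of k] by (auto simp: s_def)
  have s0: "k < d \<Longrightarrow> s k \<noteq> 0" for k using s(1)[of k] by auto
  have Ec: "E \<in> carrier_mat d r" unfolding E_def by (simp add: mult_carrier_mat[OF mat_diag_dim W])
  have Et: "transpose_mat E = transpose_mat W * mat_diag d (\<lambda>k. 1 / s k)"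
    unfolding E_def using transpose_mult[OF mat_diag_dim W]
    by (simp add: transpose_mat_diag)
  have "E * transpose_mat E = mat_diag d (\<lambda>k. 1 / s k) * (W * transpose_mat W) * mat_diag d (\<lambda>k. 1 / s k)"
    unfolding Et unfolding E_def
    using assoc_mult_mat[of "mat_diag d (\<lambda>k. 1 / s k)" d d W r "transpose_mat W * mat_diag d (\<lambda>k. 1 / s k)" d]
      assoc_mult_mat[of W d r "transpose_mat W" d "mat_diag d (\<lambda>k. 1 / s k)" d]
      mult_carrier_mat[of "transpose_mat W" r d "mat_diag d (\<lambda>k. 1 / s k)" d]
      assoc_mult_mat[of "mat_diag d (\<lambda>k. 1 / s k)" d d "W * transpose_mat W" d "mat_diag d (\<lambda>k. 1 / s k)" d]
      mat_diag_dim W by simp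
  also have "\<dots> = mat_diag d (\<lambda>k. 1)"
    unfolding WW mat_diag_diag using s0 by (intro mat_diag_cong) (simp flip: s(2))
  finally have EE: "E * transpose_mat E = 1\<^sub>m d" by simp
  have "U * mat_diag d s * E = U * (mat_diag d s * mat_diag d (\<lambda>k. 1 / s k)) * W"
    unfolding E_def
    using assoc_mult_mat[OF U(1) mat_diag_dim, of "mat_diag d (\<lambda>k. 1 / s k) * W" r s]
     assoc_mult_mat[OF mat_diag_dim mat_diag_dim W, of s "\<lambda>k. 1 / s k"]
     assoc_mult_mat[OF U(1) mat_diag_dim W] mult_carrier_mat[OF mat_diag_dim W] by simp
  also have "mat_diag d s * mat_diag d (\<lambda>k. 1 / s k) = mat_diag d (\<lambda>k. 1)"
    unfolding mat_diag_diag using s0 by (intro mat_diag_cong) simp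
  also have "U * mat_diag d (\<lambda>k. 1) * W = (U * transpose_mat U) * Y"
    unfolding W_def using U(1) Y by (simp add: assoc_mult_mat[OF U(1) _ Y])
  also have "\<dots> = Y" using U Y by simp
  finally have "Y = U * mat_diag d s * E" by simp
  then show ?thesis using U s Ec EE unfolding svd_def stiefel_def by blast
qed

section \<open>Nearest points on the Stiefel manifold\<close>

lemma sum_row_squares_stiefel:
  assumes "Z \<in> stiefel d r" "k < d"
  shows "(\<Sum>j<r. (Z $$ (k, j))\<^sup>2) = 1"
proof -
  have Z: "Z \<in> carrier_mat d r" "Z * transpose_mat Z = 1\<^sub>m d" using assms by (auto simp: stiefel_def)
  have "1 = (Z * transpose_mat Z) $$ (k, k)" using Z assms by simp
  also have "\<dots> = (\<Sum>j<r. Z $$ (k, j) * transpose_mat Z $$ (j, k))"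
    using assms Z by (intro index_mult_mat_sum) auto
  also have "\<dots> = (\<Sum>j<r. (Z $$ (k, j))\<^sup>2)"
    using assms Z by (intro sum.cong) (auto simp: power2_eq_square)
  finally show ?thesis by simp
qed

lemma orthogonal_mult_stiefel:
  assumes U: "U \<in> carrier_mat d d" "U * transpose_mat U = 1\<^sub>m d" and Z: "Z \<in> stiefel d r"
  shows "U * Z \<in> stiefel d r"
proof -
  have Zc: "Z \<in> carrier_mat d r" "Z * transpose_mat Z = 1\<^sub>m d" using Z by (auto simp: stiefel_def)
  have "U * Z * transpose_mat (U * Z) = U * (Z * transpose_mat Z) * transpose_mat U"
    unfolding transpose_mult[OF U(1) Zc(1)]
    using assoc_mult_mat[OF U(1) Zc(1), of "transpose_mat Z * transpose_mat U" d]
      assoc_mult_mat[OF Zc(1), of "transpose_mat Z" d "transpose_mat U" d]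
      assoc_mult_mat[OF U(1), of "Z * transpose_mat Z" d "transpose_mat U" d] U(1) Zc(1) by simp
  then show ?thesis using U Zc by (simp add: stiefel_def)
qed

lemma sum_squares_orthogonal_mult:
  fixes U :: "real mat"
  assumes U: "U \<in> carrier_mat d d" "transpose_mat U * U = 1\<^sub>m d" and A: "A \<in> carrier_mat d r"
  shows "(\<Sum>i<d. \<Sum>j<r. ((U * A) $$ (i, j))\<^sup>2) = (\<Sum>i<d. \<Sum>j<r. (A $$ (i, j))\<^sup>2)"
proof -
  have cols: "(\<Sum>k<d. U $$ (k, i) * U $$ (k, i')) = (if i = i' then 1 else 0)" if "i \<in> {..<d}" "i' \<in> {..<d}" for i i'
  proof -
    have "(\<Sum>k<d. U $$ (k, i) * U $$ (k, i')) = (\<Sum>k<d. transpose_mat U $$ (i, k) * U $$ (k, i'))"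
      using that U by (intro sum.cong) auto
    also have "\<dots> = (transpose_mat U * U) $$ (i, i')"
      using that U by (intro index_mult_mat_sum[symmetric]) auto
    finally show ?thesis unfolding U(2) using that by simp
  qed
  have "(\<Sum>i<d. \<Sum>j<r. ((U * A) $$ (i, j))\<^sup>2) = (\<Sum>i<d. \<Sum>j<r. (\<Sum>k<d. U $$ (i, k) * A $$ (k, j))\<^sup>2)"
    by (intro sum.cong refl) (simp add: index_mult_mat_sum[OF U(1) A])
  also have "\<dots> = (\<Sum>j<r. \<Sum>i<d. (\<Sum>k<d. U $$ (i, k) * A $$ (k, j))\<^sup>2)" by (rule sum.swap)
  also have "\<dots> = (\<Sum>j<r. \<Sum>i<d. (A $$ (i, j))\<^sup>2)"
    by (intro sum.cong refl sum_squares_orthonormal_columns cols) auto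
  also have "\<dots> = (\<Sum>i<d. \<Sum>j<r. (A $$ (i, j))\<^sup>2)" by (rule sum.swap)
  finally show ?thesis .
qed

text \<open>For unit vectors z, e the identity \<open>|z - s e|^2 = (1 - s)^2 + s |z - e|^2\<close> shows both minimality
  and uniqueness of U E.\<close>

lemma frob_diff_svd:
  assumes svd: "svd d r Y U s E" and Z: "Z \<in> stiefel d r"
  shows "(frob (Z - Y))\<^sup>2 = (\<Sum>k<d. (1 - s k)\<^sup>2)
    + (\<Sum>k<d. s k * (\<Sum>j<r. ((transpose_mat U * Z) $$ (k, j) - E $$ (k, j))\<^sup>2))"
proof -
  note S = svdD[OF svd]
  have Zc: "Z \<in> carrier_mat d r" using Z by (auto simp: stiefel_def)
  let ?Z = "transpose_mat U * Z"
  have U': "transpose_mat U \<in> carrier_mat d d" "transpose_mat (transpose_mat U) * transpose_mat U = 1\<^sub>m d"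
     "transpose_mat U * transpose_mat (transpose_mat U) = 1\<^sub>m d" using S by auto
  have Zs: "?Z \<in> stiefel d r" by (rule orthogonal_mult_stiefel[OF U'(1,3) Z])
  have Zk: "?Z \<in> carrier_mat d r" using U' Zc by simp
  have DE: "mat_diag d s * E = mat d r (\<lambda>(i, j). s i * E $$ (i, j))"
    by (rule mat_diag_mult_left[OF S(5)])
  have UY: "transpose_mat U * (Z - Y) = ?Z - mat_diag d s * E"
  proof -
    have "transpose_mat U * Y = (transpose_mat U * U) * (mat_diag d s * E)"
      unfolding S(7) using S(1,5) DE
      by (simp add: assoc_mult_mat[OF S(1) mat_diag_dim S(5)] assoc_mult_mat[of "transpose_mat U" d d U d _ r])
    then have "transpose_mat U * Y = mat_diag d s * E" using S DE by simp
    then show ?thesis using mult_minus_distrib_mat[OF U'(1) Zc S(8)] by simp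
  qed
  have "(frob (Z - Y))\<^sup>2 = (\<Sum>i<d. \<Sum>j<r. ((Z - Y) $$ (i, j))\<^sup>2)"
    using S(8) by (simp add: frob_def sum_nonneg)
  also have "\<dots> = (\<Sum>i<d. \<Sum>j<r. ((transpose_mat U * (Z - Y)) $$ (i, j))\<^sup>2)"
    using Zc S(8) by (intro sum_squares_orthogonal_mult[OF U'(1,2), symmetric]) auto
  also have "\<dots> = (\<Sum>i<d. (1 - s i)\<^sup>2 + s i * (\<Sum>j<r. (?Z $$ (i, j) - E $$ (i, j))\<^sup>2))"
  proof (intro sum.cong refl)
    fix i assume "i \<in> {..<d}"
    then have i: "i < d" by simp
    \<comment> \<open>The coefficients separate the squares of the two unit rows from the square of
      their difference, so that the row sums of the former can be replaced by 1.\<close>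
    have "(\<Sum>j<r. ((transpose_mat U * (Z - Y)) $$ (i, j))\<^sup>2)
       = (\<Sum>j<r. (1 - s i) * (?Z $$ (i, j))\<^sup>2 + (s i * s i - s i) * (E $$ (i, j))\<^sup>2
            + s i * (?Z $$ (i, j) - E $$ (i, j))\<^sup>2)"
      unfolding UY using i Zk DE
      by (intro sum.cong refl) (auto simp: power2_eq_square algebra_simps)
    also have "\<dots> = (1 - s i) + (s i * s i - s i) + s i * (\<Sum>j<r. (?Z $$ (i, j) - E $$ (i, j))\<^sup>2)"
      using sum_row_squares_stiefel[OF Zs i] sum_row_squares_stiefel[of E d r i] i svd
      by (simp add: sum.distrib sum_distrib_left[symmetric] svd_def)
    finally show "(\<Sum>j<r. ((transpose_mat U * (Z - Y)) $$ (i, j))\<^sup>2)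
        = (1 - s i)\<^sup>2 + s i * (\<Sum>j<r. (?Z $$ (i, j) - E $$ (i, j))\<^sup>2)"
      by (simp add: power2_eq_square algebra_simps)
  qed
  finally show ?thesis by (simp add: sum.distrib)
qed

text \<open>The choice operator returns U E because the minimizer is unique: the excess over the
  minimum is a sum of squared differences of rows of U^T Z and E with positive weights s, so it
  vanishes only if U^T Z = E.\<close>

lemma stiefel_proj_svd:
  assumes svd: "svd d r Y U s E"
  shows "stiefel_proj d r Y = U * E"
proof -
  note S = svdD[OF svd]
  have E: "E \<in> stiefel d r" using svd by (simp add: svd_def)
  have UE: "U * E \<in> stiefel d r" by (rule orthogonal_mult_stiefel[OF S(1,2) E])
  have U': "transpose_mat U \<in> carrier_mat d d" using S by simp
  have UUE: "transpose_mat U * (U * E) = E"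
    using assoc_mult_mat[OF U' S(1) S(5)] S by simp
  have v: "(frob (U * E - Y))\<^sup>2 = (\<Sum>k<d. (1 - s k)\<^sup>2)"
    unfolding frob_diff_svd[OF svd UE] UUE by simp
  have nn: "0 \<le> (\<Sum>k<d. s k * (\<Sum>j<r. ((transpose_mat U * Z) $$ (k, j) - E $$ (k, j))\<^sup>2))" for Z
    using S(4) by (intro sum_nonneg mult_nonneg_nonneg) (auto simp: less_imp_le)
  have f0: "0 \<le> frob M" for M unfolding frob_def by (simp add: sum_nonneg)
  have min: "frob (U * E - Y) \<le> frob (W - Y)" if "W \<in> stiefel d r" for W
    by (rule power2_le_imp_le[OF _ f0]) (use v frob_diff_svd[OF svd that] nn[of W] in simp)
  have "Z = U * E" if Z: "Z \<in> stiefel d r" and m: "\<forall>W\<in>stiefel d r. frob (Z - Y) \<le> frob (W - Y)" for Z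
  proof -
    have "(frob (Z - Y))\<^sup>2 \<le> (frob (U * E - Y))\<^sup>2" using m UE f0 by (intro power_mono) auto
    then have "(\<Sum>k<d. s k * (\<Sum>j<r. ((transpose_mat U * Z) $$ (k, j) - E $$ (k, j))\<^sup>2)) = 0"
      using v frob_diff_svd[OF svd Z] nn[of Z] by simp
    then have "\<forall>k\<in>{..<d}. s k * (\<Sum>j<r. ((transpose_mat U * Z) $$ (k, j) - E $$ (k, j))\<^sup>2) = 0"
      using S(4) by (subst (asm) sum_nonneg_eq_0_iff) (auto intro!: mult_nonneg_nonneg sum_nonneg simp: less_imp_le)
    then have "\<And>k. k < d \<Longrightarrow> (\<Sum>j<r. ((transpose_mat U * Z) $$ (k, j) - E $$ (k, j))\<^sup>2) = 0"
      using S(4) by (metis lessThan_iff mult_eq_0_iff less_irrefl)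
    then have eq: "\<And>k j. k < d \<Longrightarrow> j < r \<Longrightarrow> (transpose_mat U * Z) $$ (k, j) = E $$ (k, j)"
      by (subst (asm) sum_nonneg_eq_0_iff) auto
    have Zc: "Z \<in> carrier_mat d r" using Z by (auto simp: stiefel_def)
    have "transpose_mat U * Z = E" using eq S(1,5) Zc by (intro eq_matI) auto
    then have "U * E = (U * transpose_mat U) * Z" using assoc_mult_mat[OF S(1) U' Zc] by simp
    then show ?thesis using S Zc by simp
  qed
  then show ?thesis
    unfolding stiefel_proj_def using UE min by (intro some_equality) blast+
qed

text \<open>D is absorbed into U while s and E stay the same, so the polar factor is equivariant:
  V(D Y) = D V(Y).\<close>

lemma svd_left_orthogonal:
  assumes "svd d r Y U s E" and D: "D \<in> carrier_mat d d" "D * transpose_mat D = 1\<^sub>m d" "transpose_mat D * D = 1\<^sub>m d"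
  shows "svd d r (D * Y) (D * U) s E"
proof -
  note S = svdD[OF assms(1)]
  have "D * U * transpose_mat (D * U) = D * (U * transpose_mat U) * transpose_mat D"
    "transpose_mat (D * U) * (D * U) = transpose_mat U * (transpose_mat D * D) * U"
    using S(1) D(1)
    by (simp_all add: transpose_mult[of _ d d _ d] assoc_mult_mat[of _ d d _ d _ d] mult_carrier_mat[of _ d d _ d])
  moreover have "D * Y = D * U * mat_diag d s * E"
    unfolding S(7) using S(1,5) D(1)
    by (simp add: assoc_mult_mat[of _ d d _ d _ d] assoc_mult_mat[of _ d d _ d _ r] mult_carrier_mat[of _ d d _ d]
        mult_carrier_mat[of _ d d _ r])
  ultimately show ?thesis using S(1-3) D assms(1) by (simp add: svd_def)
qed

section \<open>Products of matrices that share the factors U and E\<close>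

lemma index_diag_sandwich:
  fixes U E :: "real mat"
  assumes "U \<in> carrier_mat d d" "E \<in> carrier_mat d r" "a < d" "b < r"
  shows "(U * mat_diag d f * E) $$ (a, b) = (\<Sum>c<d. U $$ (a, c) * f c * E $$ (c, b))"
proof -
  have "(U * mat_diag d f * E) $$ (a, b) = (\<Sum>c<d. (U * mat_diag d f) $$ (a, c) * E $$ (c, b))"
    by (rule index_mult_mat_sum[OF mult_carrier_mat[OF assms(1) mat_diag_dim] assms(2-4)])
  then show ?thesis using assms by (simp add: mat_diag_mult_right[OF assms(1)])
qed

text \<open>E E^T cancels in the middle and the diagonals multiply, so matrix identities with fixed
  U and E reduce to identities between the scalars on the diagonal. The cases needed are f = 1 for
  the polar factor, f = g for Gram matrices, and E the identity for square factorizations.\<close>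

lemma diag_sandwich_mult_transpose:
  fixes U E :: "real mat"
  assumes U: "U \<in> carrier_mat d d" and E: "E \<in> carrier_mat d r" "E * transpose_mat E = 1\<^sub>m d"
  shows "U * mat_diag d f * E * transpose_mat (U * mat_diag d g * E)
    = U * mat_diag d (\<lambda>k. f k * g k) * transpose_mat U"
proof -
  have UD: "U * mat_diag d h \<in> carrier_mat d d" for h :: "nat \<Rightarrow> real"
    by (rule mult_carrier_mat[OF U mat_diag_dim])
  have DU: "mat_diag d g * transpose_mat U \<in> carrier_mat d d" using U by (simp add: mult_carrier_mat[OF mat_diag_dim])
  have "transpose_mat (U * mat_diag d g * E) = transpose_mat E * (mat_diag d g * transpose_mat U)"
    unfolding transpose_mult[OF UD E(1)] transpose_mult[OF U mat_diag_dim] transpose_mat_diag ..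
  moreover have "U * mat_diag d f * E * (transpose_mat E * (mat_diag d g * transpose_mat U))
     = U * mat_diag d f * (E * transpose_mat E) * (mat_diag d g * transpose_mat U)"
    using E(1) assoc_mult_mat[OF UD E(1), of "transpose_mat E * (mat_diag d g * transpose_mat U)" d f]
      assoc_mult_mat[of E d r "transpose_mat E" d "mat_diag d g * transpose_mat U" d]
      assoc_mult_mat[OF UD, of "E * transpose_mat E" d "mat_diag d g * transpose_mat U" d f]
      DU mult_carrier_mat[of "transpose_mat E" r d _ d] by simp
  moreover have "U * mat_diag d f * (mat_diag d g * transpose_mat U)
     = U * (mat_diag d f * mat_diag d g) * transpose_mat U"
    using U DU by (simp add: assoc_mult_mat[of _ d d _ d _ d] mult_carrier_mat[of _ d d _ d] del: mat_diag_diag)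
  ultimately show ?thesis using right_mult_one_mat[OF UD] E(2) by simp
qed

lemma svd_polar_gram:
  assumes "svd d r Y U s E"
  shows "U * E * transpose_mat Y = U * mat_diag d s * transpose_mat U"
    and "Y * transpose_mat Y = U * mat_diag d (\<lambda>k. s k * s k) * transpose_mat U"
proof -
  note S = svdD[OF assms(1)]
  show "U * E * transpose_mat Y = U * mat_diag d s * transpose_mat U"
    using diag_sandwich_mult_transpose[OF S(1,5,6), of "\<lambda>_. 1" s] S(1)
    unfolding S(7)[symmetric] by simp
  show "Y * transpose_mat Y = U * mat_diag d (\<lambda>k. s k * s k) * transpose_mat U"
    using diag_sandwich_mult_transpose[OF S(1,5,6), of s s] unfolding S(7)[symmetric] by simp
qed

text \<open>Y Y^T is similar to the diagonal matrix of the squares of s, so its characteristic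
  polynomial splits with these roots, counted with multiplicity. The square root gives back s
  because s is positive.\<close>

lemma sum_singular_values_svd:
  assumes "svd d r Y U s E"
  shows "sum_mset (singular_values Y) = (\<Sum>k<d. s k)"
proof -
  note S = svdD[OF assms(1)]
  let ?D = "mat_diag d (\<lambda>k. s k * s k)"
  have A: "Y * transpose_mat Y \<in> carrier_mat d d" using S(8) by simp
  have "similar_mat_wit (Y * transpose_mat Y) ?D U (transpose_mat U)"
    using S(1-3) A by (intro similar_mat_witI[OF _ _ svd_polar_gram(2)[OF assms]]) auto
  then have "char_poly (Y * transpose_mat Y) = char_poly ?D"
    by (intro char_poly_similar) (auto simp: similar_mat_def)
  also have "\<dots> = (\<Prod>a\<leftarrow>diag_mat ?D. [:- a, 1:])"
    by (rule char_poly_upper_triangular[OF mat_diag_dim]) (auto simp: mat_diag_def)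
  also have "diag_mat ?D = map (\<lambda>k. s k * s k) [0..<d]"
    by (auto simp: diag_mat_def mat_diag_def intro!: map_cong)
  finally have cp: "char_poly (Y * transpose_mat Y) = (\<Prod>a\<leftarrow>map (\<lambda>k. s k * s k) [0..<d]. [:- a, 1:])" .
  have pr: "proots (\<Prod>a\<leftarrow>as. [:- a, 1:]) = mset as" for as :: "real list"
  proof (induction as)
    case (Cons a as)
    have "(\<Prod>a\<leftarrow>as. [:- a, 1:]) \<noteq> (0 :: real poly)" by (auto simp: prod_list_zero_iff)
    then show ?case using Cons by (simp add: proots_mult del: mult_pCons_left)
  qed simp
  have "sum_mset (singular_values Y) = sum_list (map (\<lambda>k. sqrt (s k * s k)) [0..<d])"
    unfolding singular_values_def cp pr by (simp add: multiset.map_comp comp_def sum_mset_sum_list[symmetric] del: upt.simps)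
  also have "\<dots> = (\<Sum>k<d. sqrt (s k * s k))"
    by (simp add: sum_list_distinct_conv_sum_set atLeast0LessThan)
  also have "\<dots> = (\<Sum>k<d. s k)"
    using S(4) by (intro sum.cong) (auto simp: less_imp_le)
  finally show ?thesis .
qed

text \<open>The matrix is U diag(s) U^T, and the trace is cyclic. Averaged over G, this identity
  ties the trace of the expectation of V(G) G^T to \<open>alpha_R\<close>.\<close>

lemma trace_polar_svd:
  assumes "svd d r Y U s E"
  shows "(\<Sum>a<d. (U * E * transpose_mat Y) $$ (a, a)) = (\<Sum>k<d. s k)"
proof -
  note S = svdD[OF assms(1)]
  have U': "transpose_mat U \<in> carrier_mat d d" using S(1) by simp
  have "(\<Sum>a<d. (U * E * transpose_mat Y) $$ (a, a)) = (\<Sum>a<d. \<Sum>c<d. s c * (transpose_mat U $$ (c, a) * U $$ (a, c)))"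
    unfolding svd_polar_gram(1)[OF assms]
    by (intro sum.cong refl) (simp add: index_diag_sandwich[OF S(1) U'] mult_ac)
  also have "\<dots> = (\<Sum>c<d. s c * (transpose_mat U * U) $$ (c, c))"
    by (subst sum.swap) (simp add: sum_distrib_left[symmetric] index_mult_mat_sum[OF U' S(1)])
  also have "\<dots> = (\<Sum>k<d. s k)" unfolding S(3) by simp
  finally show ?thesis .
qed

text \<open>The Newton-Schulz iteration: its entries are rational functions of the entries of Y divided by
  a norm, and it converges to the polar factor, which is therefore measurable in Y.\<close>

primrec newton_schulz :: "nat \<Rightarrow> real mat \<Rightarrow> nat \<Rightarrow> real mat" where
  "newton_schulz d Y 0 = (1 / frob Y) \<cdot>\<^sub>m Y"
| "newton_schulz d Y (Suc k) = (1 / 2) \<cdot>\<^sub>m ((3 \<cdot>\<^sub>m 1\<^sub>m d - newton_schulz d Y k * transpose_mat (newton_schulz d Y k))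
     * newton_schulz d Y k)"

text \<open>Taking \<open>lim\<close> entrywise gives a function on all matrices that is measurable
  in the entries. Where the iteration diverges its value is unspecified, but this happens only off
  the almost sure event on which a decomposition exists.\<close>

definition newton_schulz_limit :: "nat \<Rightarrow> nat \<Rightarrow> real mat \<Rightarrow> real mat" where
  "newton_schulz_limit d r Y = mat d r (\<lambda>(a, b). lim (\<lambda>k. newton_schulz d Y k $$ (a, b)))"

text \<open>The effect of one matrix step on a single singular value.\<close>

definition newton_schulz_scalar :: "real \<Rightarrow> real" where
  "newton_schulz_scalar x = x * (3 - x\<^sup>2) / 2"

text \<open>On (0, 1] the map does not decrease its argument and stays below 1, so the iterates
  converge to a positive fixed point, and the only one is 1.\<close>

lemma newton_schulz_scalar_tendsto:
  assumes x: "0 < x" "x \<le> 1"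
  shows "(\<lambda>k. (newton_schulz_scalar ^^ k) x) \<longlonglongrightarrow> 1"
proof -
  let ?y = "\<lambda>k. (newton_schulz_scalar ^^ k) x"
  have step: "0 < newton_schulz_scalar z \<and> newton_schulz_scalar z \<le> 1 \<and> z \<le> newton_schulz_scalar z"
    if "0 < z" "z \<le> 1" for z
  proof -
    have z2: "z\<^sup>2 \<le> 1" using that by (simp add: power_le_one)
    \<comment> \<open>The value 1 is attained to second order at z = 1, hence the squared
      factor.\<close>
    have "1 - newton_schulz_scalar z = (1 - z)\<^sup>2 * (2 + z) / 2"
      by (simp add: newton_schulz_scalar_def power2_eq_square field_simps)
    also have "\<dots> \<ge> 0" using that by simp
    finally have 1: "newton_schulz_scalar z \<le> 1" by simp
    have "newton_schulz_scalar z - z = z * (1 - z\<^sup>2) / 2"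
      by (simp add: newton_schulz_scalar_def field_simps)
    also have "\<dots> \<ge> 0" using that z2 by simp
    finally show ?thesis using 1 that by auto
  qed
  have y: "0 < ?y k \<and> ?y k \<le> 1" for k
    by (induction k) (use x step in auto)
  have inc: "incseq ?y" by (rule incseq_SucI) (use y step in auto)
  then obtain L where L: "?y \<longlonglongrightarrow> L" using incseq_convergent[of ?y 1] y by blast
  have "x \<le> L" using incseq_le[OF inc L, of 0] by simp
  then have L0: "L > 0" using x by simp
  have "(\<lambda>k. ?y (Suc k)) \<longlonglongrightarrow> L * (3 - L\<^sup>2) / 2"
    unfolding funpow.simps comp_def newton_schulz_scalar_def[of "_ x"] by (intro tendsto_intros L) auto
  moreover have "(\<lambda>k. ?y (Suc k)) \<longlonglongrightarrow> L" using L by (rule LIMSEQ_Suc)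
  ultimately have "L * (3 - L\<^sup>2) / 2 = L" by (rule LIMSEQ_unique)
  then have "L\<^sup>2 = 1" using L0 by (simp add: field_simps)
  then show ?thesis using L L0 by (simp add: power2_eq_1_iff)
qed

text \<open>Every singular value is therefore at most \<open>frob Y\<close>, so the initial scaling
  moves all of them into (0, 1], where the scalar iteration converges to 1.\<close>

lemma frob_svd:
  assumes "svd d r Y U s E"
  shows "frob Y = sqrt (\<Sum>k<d. (s k)\<^sup>2)"
proof -
  note S = svdD[OF assms(1)]
  have DE: "mat_diag d s * E = mat d r (\<lambda>(i, j). s i * E $$ (i, j))"
    by (rule mat_diag_mult_left[OF S(5)])
  have Y: "Y = U * (mat_diag d s * E)"
    unfolding S(7) by (rule assoc_mult_mat[OF S(1) mat_diag_dim S(5)])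
  have E: "E \<in> stiefel d r" using assms by (simp add: svd_def)
  have "(\<Sum>i<d. \<Sum>j<r. (Y $$ (i, j))\<^sup>2) = (\<Sum>i<d. \<Sum>j<r. ((mat_diag d s * E) $$ (i, j))\<^sup>2)"
    unfolding Y by (rule sum_squares_orthogonal_mult[OF S(1,3)]) (simp add: DE)
  also have "\<dots> = (\<Sum>i<d. (s i)\<^sup>2 * (\<Sum>j<r. (E $$ (i, j))\<^sup>2))"
    unfolding DE by (simp add: power_mult_distrib sum_distrib_left)
  also have "\<dots> = (\<Sum>i<d. (s i)\<^sup>2)" by (simp add: sum_row_squares_stiefel[OF E])
  finally show ?thesis unfolding frob_def using S(8) by simp
qed

text \<open>Each step leaves U and E alone and applies the scalar map on the diagonal: the Gram
  matrix of an iterate is diagonalized by U, and 3 times the identity is written as 3 U U^T.\<close>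

lemma newton_schulz_svd:
  assumes "svd d r Y U s E"
  shows "newton_schulz d Y k = U * mat_diag d (\<lambda>i. (newton_schulz_scalar ^^ k) (s i / frob Y)) * E"
proof (induction k)
  note S = svdD[OF assms(1)]
  have UD: "U * mat_diag d f \<in> carrier_mat d d" for f :: "nat \<Rightarrow> real"
    by (rule mult_carrier_mat[OF S(1) mat_diag_dim])
  have UDE: "U * mat_diag d f * E \<in> carrier_mat d r" for f :: "nat \<Rightarrow> real"
    by (rule mult_carrier_mat[OF UD S(5)])
  {
    case 0
    have "(1 / frob Y) \<cdot>\<^sub>m (U * mat_diag d s * E) = U * mat_diag d (\<lambda>i. s i / frob Y) * E"
      using carrier_matD[OF UDE]
      by (intro eq_matI) (simp_all add: index_diag_sandwich[OF S(1,5)] sum_divide_distrib del: index_mult_mat(1))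
    then show ?case unfolding S(7)[symmetric] by simp
  next
    case (Suc k)
    define y where "y = (\<lambda>i. (newton_schulz_scalar ^^ k) (s i / frob Y))"
    let ?V = "U * mat_diag d y * E"
    have U': "transpose_mat U \<in> carrier_mat d d" using S(1) by simp
    have UDU: "U * mat_diag d f * transpose_mat U \<in> carrier_mat d d" for f :: "nat \<Rightarrow> real"
      by (rule mult_carrier_mat[OF UD U'])
    have one: "(\<Sum>c<d. U $$ (a, c) * U $$ (b, c)) = (if a = b then 1 else 0)" if "a < d" "b < d" for a b
    proof -
      have "(\<Sum>c<d. U $$ (a, c) * U $$ (b, c)) = (U * transpose_mat U) $$ (a, b)"
        using that S(1) by (subst index_mult_mat_sum[OF S(1) U']) auto
      then show ?thesis unfolding S(2) using that by simp
    qed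
    have "3 \<cdot>\<^sub>m 1\<^sub>m d - U * mat_diag d (\<lambda>k. y k * y k) * transpose_mat U
       = U * mat_diag d (\<lambda>k. 3 - y k * y k) * transpose_mat U"
    proof (rule eq_matI)
      fix a b assume "a < dim_row (U * mat_diag d (\<lambda>k. 3 - y k * y k) * transpose_mat U)"
        "b < dim_col (U * mat_diag d (\<lambda>k. 3 - y k * y k) * transpose_mat U)"
      then have ab: "a < d" "b < d" using S(1) by auto
      have "(U * mat_diag d (\<lambda>k. 3 - y k * y k) * transpose_mat U) $$ (a, b)
         = 3 * (\<Sum>c<d. U $$ (a, c) * U $$ (b, c)) - (\<Sum>c<d. U $$ (a, c) * (y c * y c) * U $$ (b, c))"
        using ab S(1) by (simp add: index_diag_sandwich[OF S(1) U'] sum_distrib_left sum_subtractf[symmetric]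
            algebra_simps del: index_mult_mat(1))
      then show "(3 \<cdot>\<^sub>m 1\<^sub>m d - U * mat_diag d (\<lambda>k. y k * y k) * transpose_mat U) $$ (a, b)
         = (U * mat_diag d (\<lambda>k. 3 - y k * y k) * transpose_mat U) $$ (a, b)"
        using ab S(1) one[OF ab] carrier_matD[OF UDU] by (simp add: index_diag_sandwich[OF S(1) U'] del: index_mult_mat(1))
    qed (use S(1) in auto)
    moreover have "U * mat_diag d f * transpose_mat U * (U * mat_diag d g * E)
        = U * mat_diag d (\<lambda>k. f k * g k) * E" for f g :: "nat \<Rightarrow> real"
    proof -
      have "U * mat_diag d f * transpose_mat U * (U * mat_diag d g * E)
        = (U * mat_diag d f * transpose_mat U * (U * mat_diag d g)) * E"
        by (rule assoc_mult_mat[OF UDU UD S(5), symmetric])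
      also have "U * mat_diag d f * transpose_mat U * (U * mat_diag d g)
        = U * mat_diag d f * (transpose_mat U * U) * mat_diag d g"
        using S(1) by (simp add: assoc_mult_mat[of _ d d _ d _ d] mult_carrier_mat[of _ d d _ d])
      also have "\<dots> = U * (mat_diag d f * mat_diag d g)"
        unfolding S(3) using S(1) right_mult_one_mat[OF UD]
        by (simp add: assoc_mult_mat[of _ d d _ d _ d] del: mat_diag_diag)
      finally show ?thesis by simp
    qed
    ultimately have "newton_schulz d Y (Suc k) = (1 / 2) \<cdot>\<^sub>m (U * mat_diag d (\<lambda>k. (3 - y k * y k) * y k) * E)"
      using Suc diag_sandwich_mult_transpose[OF S(1,5,6), of y y] by (simp add: y_def)
    also have "\<dots> = U * mat_diag d (\<lambda>k. newton_schulz_scalar (y k)) * E"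
      using carrier_matD[OF UDE]
      by (intro eq_matI) (simp_all add: index_diag_sandwich[OF S(1,5)] sum_divide_distrib
          newton_schulz_scalar_def power2_eq_square mult_ac del: index_mult_mat(1))
    finally show ?case by (simp add: y_def)
  }
qed

lemma newton_schulz_limit_svd:
  assumes "svd d r Y U s E"
  shows "newton_schulz_limit d r Y = U * E"
proof (rule eq_matI)
  note S = svdD[OF assms(1)]
  show "dim_row (newton_schulz_limit d r Y) = dim_row (U * E)" "dim_col (newton_schulz_limit d r Y) = dim_col (U * E)"
    using S by (auto simp: newton_schulz_limit_def)
  fix a b assume "a < dim_row (U * E)" "b < dim_col (U * E)"
  then have ab: "a < d" "b < r" using S by auto
  have "s c / frob Y \<le> 1 \<and> 0 < s c / frob Y" if "c < d" for c
  proof -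
    have "(s c)\<^sup>2 \<le> (\<Sum>k<d. (s k)\<^sup>2)" using that by (intro member_le_sum) auto
    then have "s c \<le> frob Y" unfolding frob_svd[OF assms] by (rule real_le_rsqrt)
    then show ?thesis using S(4)[OF that] by simp
  qed
  then have "(\<lambda>k. (newton_schulz_scalar ^^ k) (s c / frob Y)) \<longlonglongrightarrow> 1" if "c < d" for c
    using that by (intro newton_schulz_scalar_tendsto) auto
  then have "(\<lambda>k. newton_schulz d Y k $$ (a, b)) \<longlonglongrightarrow> (\<Sum>c<d. U $$ (a, c) * 1 * E $$ (c, b))"
    unfolding newton_schulz_svd[OF assms] index_diag_sandwich[OF S(1,5) ab]
    by (intro tendsto_intros) auto
  then have "lim (\<lambda>k. newton_schulz d Y k $$ (a, b)) = (U * E) $$ (a, b)"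
    using index_mult_mat_sum[OF S(1,5) ab] by (intro limI) simp
  then show "newton_schulz_limit d r Y $$ (a, b) = (U * E) $$ (a, b)"
    using ab by (simp add: newton_schulz_limit_def)
qed

lemma measurable_newton_schulz:
  assumes F: "\<And>x. F x \<in> carrier_mat d r"
    and meas: "\<And>a b. a < d \<Longrightarrow> b < r \<Longrightarrow> (\<lambda>x. F x $$ (a, b)) \<in> borel_measurable M"
    and ab: "a < d" "b < r"
  shows "(\<lambda>x. newton_schulz d (F x) k $$ (a, b)) \<in> borel_measurable M"
  using ab
proof (induction k arbitrary: a b)
  case 0
  have "newton_schulz d (F x) 0 $$ (a, b) = 1 / sqrt (\<Sum>i<d. \<Sum>j<r. (F x $$ (i, j))\<^sup>2) * F x $$ (a, b)" for x
    using 0 F[of x] by (simp add: frob_def)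
  then show ?case using meas 0 by simp
next
  case (Suc k)
  have V: "newton_schulz d (F x) k \<in> carrier_mat d r" for x
    by (induction k) (use F[of x] in auto)
  have V': "transpose_mat (newton_schulz d (F x) k) \<in> carrier_mat r d" for x using V[of x] by simp
  have P: "3 \<cdot>\<^sub>m 1\<^sub>m d - newton_schulz d (F x) k * transpose_mat (newton_schulz d (F x) k) \<in> carrier_mat d d" for x
    using V[of x] by auto
  have "newton_schulz d (F x) (Suc k) $$ (a, b) = 1 / 2 * (\<Sum>c<d. ((if a = c then 3 else 0)
      - (\<Sum>e<r. newton_schulz d (F x) k $$ (a, e) * newton_schulz d (F x) k $$ (c, e)))
      * newton_schulz d (F x) k $$ (c, b))" for x
  proof -
    have "newton_schulz d (F x) (Suc k) $$ (a, b) = 1 / 2 * ((3 \<cdot>\<^sub>m 1\<^sub>m d - newton_schulz d (F x) k * transpose_mat (newton_schulz d (F x) k))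
       * newton_schulz d (F x) k) $$ (a, b)"
      using Suc.prems V[of x] by simp
    also have "\<dots> = 1 / 2 * (\<Sum>c<d. (3 \<cdot>\<^sub>m 1\<^sub>m d - newton_schulz d (F x) k * transpose_mat (newton_schulz d (F x) k)) $$ (a, c)
       * newton_schulz d (F x) k $$ (c, b))"
      unfolding index_mult_mat_sum[OF P V Suc.prems] ..
    also have "(\<Sum>c<d. (3 \<cdot>\<^sub>m 1\<^sub>m d - newton_schulz d (F x) k * transpose_mat (newton_schulz d (F x) k)) $$ (a, c)
       * newton_schulz d (F x) k $$ (c, b)) = (\<Sum>c<d. ((if a = c then 3 else 0)
      - (\<Sum>e<r. newton_schulz d (F x) k $$ (a, e) * newton_schulz d (F x) k $$ (c, e)))
      * newton_schulz d (F x) k $$ (c, b))"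
    proof (intro sum.cong refl arg_cong2[where f="(*)"])
      fix c assume "c \<in> {..<d}"
      then have c: "c < d" by simp
      have "(newton_schulz d (F x) k * transpose_mat (newton_schulz d (F x) k)) $$ (a, c)
        = (\<Sum>e<r. newton_schulz d (F x) k $$ (a, e) * newton_schulz d (F x) k $$ (c, e))"
        using c V[of x] by (subst index_mult_mat_sum[OF V V' Suc.prems(1) c]) auto
      then show "(3 \<cdot>\<^sub>m 1\<^sub>m d - newton_schulz d (F x) k * transpose_mat (newton_schulz d (F x) k)) $$ (a, c)
        = (if a = c then 3 else 0) - (\<Sum>e<r. newton_schulz d (F x) k $$ (a, e) * newton_schulz d (F x) k $$ (c, e))"
        using c Suc.prems carrier_matD[OF V[of x]] by (simp del: index_mult_mat(1))
    qed
    finally show ?thesis .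
  qed
  then show ?case using Suc.IH Suc.prems
    by (simp only:) (intro borel_measurable_times borel_measurable_sum borel_measurable_diff borel_measurable_const; simp)
qed

lemma measurable_newton_schulz_limit:
  assumes F: "\<And>x. F x \<in> carrier_mat d r"
    and meas: "\<And>a b. a < d \<Longrightarrow> b < r \<Longrightarrow> (\<lambda>x. F x $$ (a, b)) \<in> borel_measurable M"
    and ab: "a < d" "b < r"
  shows "(\<lambda>x. newton_schulz_limit d r (F x) $$ (a, b)) \<in> borel_measurable M"
  using ab measurable_newton_schulz[OF F meas ab]
  by (simp add: newton_schulz_limit_def borel_measurable_lim_metric)

subsection \<open>Gaussian matrices\<close>

abbreviation gauss_index :: "real \<Rightarrow> 'i set \<Rightarrow> ('i \<Rightarrow> real) measure" where
  "gauss_index \<sigma> I \<equiv> PiM I (\<lambda>_. density lborel (normal_density 0 \<sigma>))"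

lemma sets_gauss_index [measurable_cong]: "sets (gauss_index \<sigma> I) = sets (PiM I (\<lambda>_. borel))"
  by (rule sets_PiM_cong) auto

lemma prob_space_gauss_index: "\<sigma> > 0 \<Longrightarrow> prob_space (gauss_index \<sigma> I)"
  by (intro prob_space_PiM prob_space_normal_density)

lemma integrable_gauss_index_square:
  assumes \<sigma>: "\<sigma> > 0" and i: "i \<in> I"
  shows "integrable (gauss_index \<sigma> I) (\<lambda>x. (x i)\<^sup>2)"
    and "(\<integral>x. (x i)\<^sup>2 \<partial>gauss_index \<sigma> I) = \<sigma>\<^sup>2"
proof -
  let ?N = "density lborel (normal_density 0 \<sigma>)"
  have d: "distr (gauss_index \<sigma> I) ?N (\<lambda>x. x i) = ?N"
    using i \<sigma> by (intro distr_PiM_component prob_space_normal_density) auto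
  have m: "(\<lambda>x. x i) \<in> gauss_index \<sigma> I \<rightarrow>\<^sub>M ?N" using i by measurable
  have "has_bochner_integral lborel (\<lambda>x. normal_density 0 \<sigma> x * x\<^sup>2) (\<sigma>\<^sup>2)"
    using normal_moment_even[OF \<sigma>, of 0 1] \<sigma> by (simp add: fact_2)
  then have h: "has_bochner_integral ?N (\<lambda>x. x\<^sup>2) (\<sigma>\<^sup>2)"
    by (intro has_bochner_integral_density) auto
  then show "integrable (gauss_index \<sigma> I) (\<lambda>x. (x i)\<^sup>2)"
    using integrable_distr_eq[OF m, of "\<lambda>x. x\<^sup>2"] unfolding d by (simp add: has_bochner_integral_iff)
  show "(\<integral>x. (x i)\<^sup>2 \<partial>gauss_index \<sigma> I) = \<sigma>\<^sup>2"
    using integral_distr[OF m, of "\<lambda>x. x\<^sup>2"] h unfolding d by (simp add: has_bochner_integral_iff)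
qed

lemma integrable_gauss_index_product:
  assumes \<sigma>: "\<sigma> > 0" and ij: "i \<in> I" "j \<in> I"
  shows "integrable (gauss_index \<sigma> I) (\<lambda>x. x i * x j)"
proof (rule Bochner_Integration.integrable_bound)
  show "integrable (gauss_index \<sigma> I) (\<lambda>x. (x i)\<^sup>2 + (x j)\<^sup>2)"
    using ij \<sigma> by (intro Bochner_Integration.integrable_add integrable_gauss_index_square)
  show "(\<lambda>x. x i * x j) \<in> borel_measurable (gauss_index \<sigma> I)" using ij by measurable
  have "\<bar>a * b\<bar> \<le> a\<^sup>2 + b\<^sup>2" for a b :: real
  proof -
    have "2 * (\<bar>a\<bar> * \<bar>b\<bar>) \<le> a\<^sup>2 + b\<^sup>2" using sum_squares_bound[of "\<bar>a\<bar>" "\<bar>b\<bar>"] by simp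
    moreover have "0 \<le> \<bar>a\<bar> * \<bar>b\<bar>" by simp
    ultimately show ?thesis unfolding abs_mult by linarith
  qed
  then show "AE x in gauss_index \<sigma> I. norm (x i * x j) \<le> norm ((x i)\<^sup>2 + (x j)\<^sup>2)" by simp
qed

lemma integrable_gauss_index_component:
  assumes \<sigma>: "\<sigma> > 0" and i: "i \<in> I"
  shows "integrable (gauss_index \<sigma> I) (\<lambda>x. x i)"
proof (rule Bochner_Integration.integrable_bound)
  interpret prob_space "gauss_index \<sigma> I" using \<sigma> by (rule prob_space_gauss_index)
  show "integrable (gauss_index \<sigma> I) (\<lambda>x. 1 + (x i)\<^sup>2)"
    using assms by (intro Bochner_Integration.integrable_add integrable_gauss_index_square) auto
  show "(\<lambda>x. x i) \<in> borel_measurable (gauss_index \<sigma> I)" using i by measurable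
  have "\<bar>a\<bar> \<le> 1 + a\<^sup>2" for a :: real
    using sum_squares_bound[of 1 "\<bar>a\<bar>"] by simp
  then show "AE x in gauss_index \<sigma> I. norm (x i) \<le> norm (1 + (x i)\<^sup>2)" by simp
qed

text \<open>For i and j distinct, flipping the sign of coordinate i preserves the law and negates
  the product, so the integral is its own negative.\<close>

lemma integral_gauss_index_product:
  assumes \<sigma>: "\<sigma> > 0" and I: "finite I" and ij: "i \<in> I" "j \<in> I"
  shows "(\<integral>x. x i * x j \<partial>gauss_index \<sigma> I) = (if i = j then \<sigma>\<^sup>2 else 0)"
proof (cases "i = j")
  case True
  then show ?thesis using integrable_gauss_index_square(2)[OF \<sigma> ij(1)] by (simp add: power2_eq_square)
next
  case False
  \<comment> \<open>The diagonal matrix that flips coordinate i.\<close>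
  define a where "a = (\<lambda>k l. if k = l then (if k = i then - 1 else 1) else (0::real))"
  let ?T = "\<lambda>x. \<lambda>k\<in>I. \<Sum>l\<in>I. a k l * x l"
  have rows: "(\<Sum>l\<in>I. a k l * a k' l) = (if k = k' then 1 else 0)" if "k \<in> I" "k' \<in> I" for k k'
  proof -
    have "(\<Sum>l\<in>I. a k l * a k' l) = (\<Sum>l\<in>I. if l = k then a k k * a k' k else 0)"
      by (intro sum.cong) (auto simp: a_def)
    then show ?thesis using that I by (simp add: a_def)
  qed
  have T: "?T x k = (if k = i then - x k else x k)" if "k \<in> I" for x k
  proof -
    have "(\<Sum>l\<in>I. a k l * x l) = (\<Sum>l\<in>I. if l = k then a k k * x k else 0)"
      by (intro sum.cong) (auto simp: a_def)
    then show ?thesis using that I by (simp add: a_def)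
  qed
  have [measurable]: "?T \<in> gauss_index \<sigma> I \<rightarrow>\<^sub>M gauss_index \<sigma> I" by measurable
  have "(\<integral>x. x i * x j \<partial>gauss_index \<sigma> I) = (\<integral>x. x i * x j \<partial>distr (gauss_index \<sigma> I) (gauss_index \<sigma> I) ?T)"
    using distr_gauss_orthonormal_rows[OF I I \<sigma> rows] by simp
  also have "\<dots> = (\<integral>x. ?T x i * ?T x j \<partial>gauss_index \<sigma> I)"
    using ij by (intro integral_distr) measurable
  also have "\<dots> = - (\<integral>x. x i * x j \<partial>gauss_index \<sigma> I)"
    using ij False by (simp only: T) simp
  finally show ?thesis using False by simp
qed

section \<open>Left multiplication of Gaussian matrices by matrices with orthonormal rows\<close>

abbreviation mat_index :: "nat \<Rightarrow> nat \<Rightarrow> (nat \<times> nat) set" where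
  "mat_index m k \<equiv> {..<m} \<times> {..<k}"

text \<open>The restriction to the index set places the result in the space of the product measure,
  whose points are extensional functions.\<close>

definition mat_entries :: "nat \<Rightarrow> nat \<Rightarrow> real mat \<Rightarrow> nat \<times> nat \<Rightarrow> real" where
  "mat_entries m k M = (\<lambda>p\<in>mat_index m k. M $$ p)"

lemma to_mat_carrier [simp]: "to_mat m k g \<in> carrier_mat m k"
  by (simp add: to_mat_def)

lemma to_mat_mat_entries: "M \<in> carrier_mat m k \<Longrightarrow> to_mat m k (mat_entries m k M) = M"
  by (auto simp: to_mat_def mat_entries_def)

lemma index_mult_to_mat:
  assumes "A \<in> carrier_mat m n" "p < m" "k < r"
  shows "(A * to_mat n r R) $$ (p, k) = (\<Sum>i<n. A $$ (p, i) * R (i, k))"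
  using assms by (subst index_mult_mat_sum[OF assms(1) to_mat_carrier assms(2,3)]) (simp add: to_mat_def)

lemma measurable_mult_to_mat:
  assumes "A \<in> carrier_mat m n" "p < m" "k < r"
  shows "(\<lambda>R. (A * to_mat n r R) $$ (p, k)) \<in> borel_measurable (gauss_index \<sigma> (mat_index n r))"
  unfolding index_mult_to_mat[OF assms] using assms
  by (intro borel_measurable_sum borel_measurable_times borel_measurable_const) measurable

text \<open>On the family of all entries, R to A R is the Kronecker product of A with the r x r
  identity, and this inherits orthonormal rows from A. The function a in the proof is this Kronecker
  product.\<close>

lemma distr_gauss_mult_orthonormal:
  assumes A: "A \<in> carrier_mat m n" "A * transpose_mat A = 1\<^sub>m m" and \<sigma>: "\<sigma> > 0"
  shows "distr (gauss_index \<sigma> (mat_index n r)) (gauss_index \<sigma> (mat_index m r))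
      (\<lambda>R. mat_entries m r (A * to_mat n r R)) = gauss_index \<sigma> (mat_index m r)"
    and "(\<lambda>R. mat_entries m r (A * to_mat n r R))
      \<in> gauss_index \<sigma> (mat_index n r) \<rightarrow>\<^sub>M gauss_index \<sigma> (mat_index m r)"
proof -
  define a :: "nat \<times> nat \<Rightarrow> nat \<times> nat \<Rightarrow> real" where "a = (\<lambda>(p, k) (i, l). if k = l then A $$ (p, i) else 0)"
  have inner: "(\<Sum>t\<in>mat_index n r. a (p, k) t * f t) = (\<Sum>i<n. A $$ (p, i) * f (i, k))" if "k < r" for p k f
  proof -
    have "(\<Sum>t\<in>mat_index n r. a (p, k) t * f t) = (\<Sum>i<n. \<Sum>l<r. a (p, k) (i, l) * f (i, l))"
      by (simp add: sum.cartesian_product)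
    also have "\<dots> = (\<Sum>i<n. \<Sum>l<r. if l = k then A $$ (p, i) * f (i, k) else 0)"
      by (intro sum.cong refl) (auto simp: a_def)
    finally show ?thesis using that by simp
  qed
  have rows: "(\<Sum>t\<in>mat_index n r. a j t * a j' t) = (if j = j' then 1 else 0)"
    if jj: "j \<in> mat_index m r" "j' \<in> mat_index m r" for j j'
  proof -
    obtain p k p' k' where j: "j = (p, k)" "j' = (p', k')" "p < m" "k < r" "p' < m" "k' < r"
      using jj by (cases j; cases j') auto
    have "(\<Sum>t\<in>mat_index n r. a j t * a j' t) = (\<Sum>i<n. A $$ (p, i) * (if k' = k then A $$ (p', i) else 0))"
      unfolding j(1) inner[OF j(4)] unfolding j(2) a_def by simp
    also have "\<dots> = (if k' = k then (\<Sum>i<n. A $$ (p, i) * transpose_mat A $$ (i, p')) else 0)"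
      using A(1) j by (auto intro!: sum.cong)
    also have "(\<Sum>i<n. A $$ (p, i) * transpose_mat A $$ (i, p')) = (A * transpose_mat A) $$ (p, p')"
      using A(1) j by (intro index_mult_mat_sum[symmetric]) auto
    finally show ?thesis unfolding A(2) using j by auto
  qed
  have eq: "(\<lambda>R. \<lambda>j\<in>mat_index m r. \<Sum>t\<in>mat_index n r. a j t * R t) = (\<lambda>R. mat_entries m r (A * to_mat n r R))"
    by (auto simp: fun_eq_iff mat_entries_def restrict_def index_mult_to_mat[OF A(1)] inner)
  show "distr (gauss_index \<sigma> (mat_index n r)) (gauss_index \<sigma> (mat_index m r))
      (\<lambda>R. mat_entries m r (A * to_mat n r R)) = gauss_index \<sigma> (mat_index m r)"
    using distr_gauss_orthonormal_rows[of "mat_index n r" "mat_index m r", OF _ _ \<sigma> rows] unfolding eq by simp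
  show "(\<lambda>R. mat_entries m r (A * to_mat n r R))
      \<in> gauss_index \<sigma> (mat_index n r) \<rightarrow>\<^sub>M gauss_index \<sigma> (mat_index m r)"
    unfolding eq[symmetric] by measurable
qed

lemma AE_gauss_mult_orthonormal:
  assumes "A \<in> carrier_mat m n" "A * transpose_mat A = 1\<^sub>m m" "\<sigma> > 0"
    and "AE G in gauss_index \<sigma> (mat_index m r). P (to_mat m r G)"
  shows "AE R in gauss_index \<sigma> (mat_index n r). P (A * to_mat n r R)"
proof -
  have "AE R in gauss_index \<sigma> (mat_index n r). P (to_mat m r (mat_entries m r (A * to_mat n r R)))"
    by (rule AE_distrD[OF distr_gauss_mult_orthonormal(2)[OF assms(1-3)], of "\<lambda>G. P (to_mat m r G)"])
      (simp only: distr_gauss_mult_orthonormal(1)[OF assms(1-3)] assms(4))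
  moreover have "A * to_mat n r R \<in> carrier_mat m r" for R using assms(1) by (auto intro: mult_carrier_mat)
  ultimately show ?thesis by (simp add: to_mat_mat_entries)
qed

lemma integral_gauss_mult_orthonormal:
  fixes h :: "real mat \<Rightarrow> real"
  assumes A: "A \<in> carrier_mat m n" "A * transpose_mat A = 1\<^sub>m m" "\<sigma> > 0"
    and h: "(\<lambda>G. h (to_mat m r G)) \<in> borel_measurable (gauss_index \<sigma> (mat_index m r))"
  shows "(\<integral>R. h (A * to_mat n r R) \<partial>gauss_index \<sigma> (mat_index n r))
    = (\<integral>G. h (to_mat m r G) \<partial>gauss_index \<sigma> (mat_index m r))"
proof -
  have "A * to_mat n r R \<in> carrier_mat m r" for R using A(1) by (auto intro: mult_carrier_mat)
  then have "(\<integral>R. h (A * to_mat n r R) \<partial>gauss_index \<sigma> (mat_index n r))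
    = (\<integral>R. h (to_mat m r (mat_entries m r (A * to_mat n r R))) \<partial>gauss_index \<sigma> (mat_index n r))"
    by (simp add: to_mat_mat_entries)
  also have "\<dots> = (\<integral>G. h (to_mat m r G) \<partial>distr (gauss_index \<sigma> (mat_index n r)) (gauss_index \<sigma> (mat_index m r))
      (\<lambda>R. mat_entries m r (A * to_mat n r R)))"
    by (rule integral_distr[symmetric, OF distr_gauss_mult_orthonormal(2)[OF A] h])
  finally show ?thesis unfolding distr_gauss_mult_orthonormal(1)[OF A] .
qed

text \<open>As a function of t the determinant is the characteristic polynomial of - A, which is
  monic and hence has finitely many roots.\<close>

lemma finite_singular_shifts:
  fixes A :: "real mat"
  assumes A: "A \<in> carrier_mat d d"
  shows "finite {t. det (A + t \<cdot>\<^sub>m 1\<^sub>m d) = 0}"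
proof -
  have "- char_matrix (- A) t = A + t \<cdot>\<^sub>m 1\<^sub>m d" for t
    using A by (intro eq_matI) (auto simp: char_matrix_def)
  then have "{t. det (A + t \<cdot>\<^sub>m 1\<^sub>m d) = 0} = {t. poly (char_poly (- A)) t = 0}"
    using char_poly_matrix[of "- A" d] A by simp
  moreover have "char_poly (- A) \<noteq> 0" using degree_monic_char_poly[of "- A" d] A by auto
  ultimately show ?thesis by (simp add: poly_roots_finite)
qed

text \<open>Averaging over the shifts \<open>G + t [1 0]\<close>: for fixed G only finitely many t are singular, and by
  translation invariance the measure of the singular set does not depend on t.\<close>

lemma AE_gauss_det_nonzero:
  assumes dr: "d \<le> r" and \<sigma>: "\<sigma> > 0"
  shows "AE G in gauss_index \<sigma> (mat_index d r). det (mat d d (\<lambda>(i, j). to_mat d r G $$ (i, j))) \<noteq> 0"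
proof -
  let ?I = "mat_index d r"
  let ?L = "lebesgue_on_index ?I"
  define D where "D = (\<lambda>G :: nat \<times> nat \<Rightarrow> real. det (mat d d (\<lambda>(i, j). G (i, j))))"
  \<comment> \<open>The Leibniz formula exhibits the determinant as a polynomial in the entries,
    which gives measurability.\<close>
  have D_alt: "D G = (\<Sum>p\<in>{p. p permutes {0..<d}}. signof p * (\<Prod>i = 0..<d. G (i, p i)))" for G
  proof -
    have "p i < d" if "p permutes {0..<d}" "i < d" for p i using permutes_in_image[OF that(1), of i] that(2) by simp
    then show ?thesis unfolding D_def by (subst det_def'[of _ d]) (auto intro!: sum.cong prod.cong)
  qed
  have [measurable]: "D \<in> borel_measurable ?L"
  proof -
    have "(\<lambda>G. G (i, p i)) \<in> borel_measurable ?L" if "p permutes {0..<d}" "i \<in> {0..<d}" for p i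
    proof -
      have "(i, p i) \<in> ?I" using permutes_in_image[OF that(1), of i] that(2) dr by auto
      then have "(\<lambda>G. G (i, p i)) \<in> ?L \<rightarrow>\<^sub>M (lborel :: real measure)" by (rule measurable_component_singleton)
      then show ?thesis by simp
    qed
    then show ?thesis unfolding D_alt[abs_def]
      by (intro borel_measurable_sum borel_measurable_times borel_measurable_const borel_measurable_prod) auto
  qed
  define h :: "(nat \<times> nat \<Rightarrow> real) \<Rightarrow> ennreal" where "h = (\<lambda>G. indicator {0} (D G))"
  have [measurable]: "h \<in> borel_measurable ?L" unfolding h_def by measurable
  let ?s = "\<lambda>t G. \<lambda>p\<in>?I. G p + (if fst p = snd p then t else 0)"
  interpret L: finite_product_sigma_finite "\<lambda>_. lborel :: real measure" ?I by standard auto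
  interpret P: pair_sigma_finite "lborel :: real measure" ?L ..
  have z: "(\<integral>\<^sup>+t. h (?s t G) \<partial>lborel) = 0" for G
  proof -
    let ?G = "mat d d (\<lambda>(i, j). G (i, j))"
    have "mat d d (\<lambda>(i, j). ?s t G (i, j)) = ?G + t \<cdot>\<^sub>m 1\<^sub>m d" for t
      using dr by (intro eq_matI) auto
    then have "D (?s t G) = det (?G + t \<cdot>\<^sub>m 1\<^sub>m d)" for t unfolding D_def by (simp only:)
    then have "h (?s t G) = indicator {t. det (?G + t \<cdot>\<^sub>m 1\<^sub>m d) = 0} t" for t
      by (simp add: h_def indicator_def)
    moreover have "{t. det (?G + t \<cdot>\<^sub>m 1\<^sub>m d) = 0} \<in> null_sets lborel"
      by (intro finite_imp_null_set_lborel finite_singular_shifts) simp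
    ultimately show ?thesis by (simp add: null_sets_def)
  qed
  \<comment> \<open>The measure of the singular set is integrated over all real t. The result is
    infinity times this measure, and it can be zero only if the measure is zero.\<close>
  have "(\<integral>\<^sup>+G. h G \<partial>?L) * \<infinity> = (\<integral>\<^sup>+t. (\<integral>\<^sup>+G. h G \<partial>?L) \<partial>(lborel :: real measure))" by simp
  also have "\<dots> = (\<integral>\<^sup>+t. (\<integral>\<^sup>+G. h (?s t G) \<partial>?L) \<partial>lborel)"
    by (subst nn_integral_PiM_lborel_translate) auto
  also have "\<dots> = (\<integral>\<^sup>+G. (\<integral>\<^sup>+t. h (?s t G) \<partial>lborel) \<partial>?L)"
    by (rule P.Fubini'[symmetric]) measurable
  also have "\<dots> = 0" by (simp add: z)
  finally have "(\<integral>\<^sup>+G. h G \<partial>?L) = 0" by (simp add: ennreal_mult_eq_top_iff split: if_splits)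
  then have "AE G in ?L. h G = 0" by (subst (asm) nn_integral_0_iff_AE) auto
  then have "AE G in ?L. D G \<noteq> 0" by eventually_elim (auto simp: h_def)
  then have "AE G in gauss_index \<sigma> ?I. D G \<noteq> 0"
    using \<sigma> by (subst PiM_normal_density) (auto simp: AE_density)
  moreover have "mat d d (\<lambda>(i, j). to_mat d r G $$ (i, j)) = mat d d (\<lambda>(i, j). G (i, j))" for G
    using dr by (intro eq_matI) (auto simp: to_mat_def)
  ultimately show ?thesis by (simp add: D_def)
qed

subsection \<open>Correlations of the rounded Gaussian matrix\<close>

text \<open>In a completed measure every function that agrees almost everywhere with a measurable
  one is measurable. This is how integrals of expressions defined by choice or by polynomial roots
  are evaluated through a measurable representative.\<close>

lemma integral_completion_AE:
  fixes f h :: "'a \<Rightarrow> real"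
  assumes h: "h \<in> borel_measurable M" and eq: "AE x in M. f x = h x"
  shows "(\<integral>x. f x \<partial>completion M) = (\<integral>x. h x \<partial>M)"
proof -
  have h': "h \<in> borel_measurable (completion M)" using h by (rule measurable_completion)
  have eq': "AE x in completion M. f x = h x" using eq by (rule AE_completion)
  have "f \<in> borel_measurable (completion M)"
  proof (rule measurableI)
    fix A :: "real set" assume A: "A \<in> sets borel"
    show "f -` A \<inter> space (completion M) \<in> sets (completion M)"
    proof (rule completion.in_sets_AE[where A="h -` A \<inter> space (completion M)"])
      show "AE x in completion M. x \<in> h -` A \<inter> space (completion M) \<longleftrightarrow> x \<in> f -` A \<inter> space (completion M)"
        using eq' by eventually_elim auto
    qed (use measurable_sets[OF h' A] in auto)
  qed simp
  then have "(\<integral>x. f x \<partial>completion M) = (\<integral>x. h x \<partial>completion M)"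
    using h' eq' by (intro integral_cong_AE) auto
  then show ?thesis using h by (simp add: integral_completion)
qed

lemma integral_sum2:
  fixes f :: "'i \<Rightarrow> 'j \<Rightarrow> 'a \<Rightarrow> real"
  assumes "\<And>i j. i \<in> A \<Longrightarrow> j \<in> B \<Longrightarrow> integrable M (f i j)"
  shows "(\<integral>x. (\<Sum>i\<in>A. \<Sum>j\<in>B. f i j x) \<partial>M) = (\<Sum>i\<in>A. \<Sum>j\<in>B. \<integral>x. f i j x \<partial>M)"
proof -
  have "(\<integral>x. (\<Sum>i\<in>A. \<Sum>j\<in>B. f i j x) \<partial>M) = (\<Sum>i\<in>A. \<integral>x. (\<Sum>j\<in>B. f i j x) \<partial>M)"
    using assms by (intro Bochner_Integration.integral_sum Bochner_Integration.integrable_sum)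
  also have "\<dots> = (\<Sum>i\<in>A. \<Sum>j\<in>B. \<integral>x. f i j x \<partial>M)"
    using assms by (intro sum.cong refl Bochner_Integration.integral_sum)
  finally show ?thesis .
qed

lemma integral_sum4:
  fixes f :: "'i \<Rightarrow> 'j \<Rightarrow> 'k \<Rightarrow> 'l \<Rightarrow> 'a \<Rightarrow> real"
  assumes "\<And>i j k l. i \<in> A \<Longrightarrow> j \<in> B \<Longrightarrow> k \<in> S \<Longrightarrow> l \<in> T \<Longrightarrow> integrable M (f i j k l)"
  shows "(\<integral>x. (\<Sum>i\<in>A. \<Sum>j\<in>B. \<Sum>k\<in>S. \<Sum>l\<in>T. f i j k l x) \<partial>M)
    = (\<Sum>i\<in>A. \<Sum>j\<in>B. \<Sum>k\<in>S. \<Sum>l\<in>T. \<integral>x. f i j k l x \<partial>M)"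
proof -
  have "(\<integral>x. (\<Sum>i\<in>A. \<Sum>j\<in>B. \<Sum>k\<in>S. \<Sum>l\<in>T. f i j k l x) \<partial>M)
    = (\<Sum>i\<in>A. \<Sum>j\<in>B. \<integral>x. (\<Sum>k\<in>S. \<Sum>l\<in>T. f i j k l x) \<partial>M)"
    using assms by (intro integral_sum2 Bochner_Integration.integrable_sum)
  also have "\<dots> = (\<Sum>i\<in>A. \<Sum>j\<in>B. \<Sum>k\<in>S. \<Sum>l\<in>T. \<integral>x. f i j k l x \<partial>M)"
    using assms by (intro sum.cong refl integral_sum2)
  finally show ?thesis .
qed

lemma abs_entry_stiefel_le_1:
  assumes Z: "Z \<in> stiefel d r" and ab: "a < d" "b < r"
  shows "\<bar>Z $$ (a, b)\<bar> \<le> 1"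
proof -
  have "(Z $$ (a, b))\<^sup>2 \<le> (\<Sum>j<r. (Z $$ (a, j))\<^sup>2)" using ab by (intro member_le_sum) auto
  then show ?thesis using sum_row_squares_stiefel[OF Z ab(1)] by (simp add: abs_square_le_1)
qed

section \<open>The polar factor of a Gaussian matrix: existence, measurability,
  integrability\<close>

lemma AE_gauss_matrix_svd:
  assumes dr: "d \<le> r" and \<sigma>: "\<sigma> > 0"
  shows "AE G in gauss_index \<sigma> (mat_index d r). \<exists>U s E. svd d r (to_mat d r G) U s E"
  using AE_gauss_det_nonzero[OF dr \<sigma>] by eventually_elim (rule svd_exists[OF to_mat_carrier dr])

lemma AE_gauss_svd:
  assumes dr: "d \<le> r" and \<sigma>: "\<sigma> > 0" and X: "X \<in> carrier_mat d m" "X * transpose_mat X = 1\<^sub>m d"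
  shows "AE R in gauss_index \<sigma> (mat_index m r). \<exists>U s E. svd d r (X * to_mat m r R) U s E"
  by (rule AE_gauss_mult_orthonormal[OF X \<sigma> AE_gauss_matrix_svd[OF dr \<sigma>]])

lemma newton_schulz_limit_in_stiefel:
  assumes "\<exists>U s E. svd d r Y U s E"
  shows "newton_schulz_limit d r Y \<in> stiefel d r" "stiefel_proj d r Y = newton_schulz_limit d r Y"
  using assms by (auto simp: newton_schulz_limit_svd stiefel_proj_svd svd_def intro: orthogonal_mult_stiefel)

lemma measurable_polar_gauss:
  assumes X: "X \<in> carrier_mat d m" and ab: "a < d" "k < r"
  shows "(\<lambda>R. newton_schulz_limit d r (X * to_mat m r R) $$ (a, k)) \<in> borel_measurable (gauss_index \<sigma> (mat_index m r))"
  using X by (intro measurable_newton_schulz_limit[OF _ _ ab] measurable_mult_to_mat mult_carrier_mat) auto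

text \<open>Almost surely the polar factor lies on the Stiefel manifold, so its entries are bounded
  by 1 and f dominates the product.\<close>

lemma integrable_polar_times:
  assumes dr: "d \<le> r" and \<sigma>: "\<sigma> > 0" and X: "X \<in> carrier_mat d m" "X * transpose_mat X = 1\<^sub>m d"
    and ak: "a < d" "k < r" and f: "integrable (gauss_index \<sigma> (mat_index m r)) f"
  shows "integrable (gauss_index \<sigma> (mat_index m r)) (\<lambda>R. newton_schulz_limit d r (X * to_mat m r R) $$ (a, k) * f R)"
proof (rule Bochner_Integration.integrable_bound[OF f])
  show "(\<lambda>R. newton_schulz_limit d r (X * to_mat m r R) $$ (a, k) * f R) \<in> borel_measurable (gauss_index \<sigma> (mat_index m r))"
    by (intro borel_measurable_times measurable_polar_gauss[OF X(1) ak] borel_measurable_integrable[OF f])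
  show "AE R in gauss_index \<sigma> (mat_index m r). norm (newton_schulz_limit d r (X * to_mat m r R) $$ (a, k) * f R) \<le> norm (f R)"
    using AE_gauss_svd[OF dr \<sigma> X]
  proof eventually_elim
    case (elim R)
    have "\<bar>newton_schulz_limit d r (X * to_mat m r R) $$ (a, k)\<bar> \<le> 1"
      by (rule abs_entry_stiefel_le_1[OF newton_schulz_limit_in_stiefel(1)[OF elim] ak])
    then show ?case by (simp add: abs_mult mult_left_le_one_le)
  qed
qed

lemma integrable_mult_to_mat:
  assumes \<sigma>: "\<sigma> > 0" and Z: "Z \<in> carrier_mat d m" and bk: "b < d" "k < r"
  shows "integrable (gauss_index \<sigma> (mat_index m r)) (\<lambda>R. (Z * to_mat m r R) $$ (b, k))"
  unfolding index_mult_to_mat[OF Z bk] using bk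
  by (intro Bochner_Integration.integrable_sum integrable_mult_right integrable_gauss_index_component[OF \<sigma>]) auto

text \<open>Distinct entries of R are uncorrelated, so of the double sum over p and q only the
  diagonal survives.\<close>

lemma integral_mult_to_mat_product:
  assumes \<sigma>: "\<sigma> > 0" and X: "X \<in> carrier_mat d m" and Z: "Z \<in> carrier_mat d m" and ak: "a < d" "b < d" "k < r"
  shows "integrable (gauss_index \<sigma> (mat_index m r)) (\<lambda>R. (X * to_mat m r R) $$ (a, k) * (Z * to_mat m r R) $$ (b, k))"
    and "(\<integral>R. (X * to_mat m r R) $$ (a, k) * (Z * to_mat m r R) $$ (b, k) \<partial>gauss_index \<sigma> (mat_index m r))
      = \<sigma>\<^sup>2 * (\<Sum>p<m. X $$ (a, p) * Z $$ (b, p))"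
proof -
  let ?M = "gauss_index \<sigma> (mat_index m r)"
  have eq: "(X * to_mat m r R) $$ (a, k) * (Z * to_mat m r R) $$ (b, k)
    = (\<Sum>p<m. \<Sum>q<m. (X $$ (a, p) * Z $$ (b, q)) * (R (p, k) * R (q, k)))" for R
    unfolding index_mult_to_mat[OF X ak(1,3)] index_mult_to_mat[OF Z ak(2,3)] sum_product
    by (simp add: mult_ac)
  have int: "integrable ?M (\<lambda>R. (X $$ (a, p) * Z $$ (b, q)) * (R (p, k) * R (q, k)))" if "p < m" "q < m" for p q
    using that ak by (intro integrable_mult_right integrable_gauss_index_product[OF \<sigma>]) auto
  show "integrable ?M (\<lambda>R. (X * to_mat m r R) $$ (a, k) * (Z * to_mat m r R) $$ (b, k))"
    unfolding eq by (intro Bochner_Integration.integrable_sum int) auto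
  have "(\<integral>R. (X * to_mat m r R) $$ (a, k) * (Z * to_mat m r R) $$ (b, k) \<partial>?M)
     = (\<Sum>p<m. \<Sum>q<m. \<integral>R. (X $$ (a, p) * Z $$ (b, q)) * (R (p, k) * R (q, k)) \<partial>?M)"
    unfolding eq by (intro integral_sum2 int) auto
  also have "\<dots> = (\<Sum>p<m. \<Sum>q<m. if q = p then X $$ (a, p) * Z $$ (b, p) * \<sigma>\<^sup>2 else 0)"
    using ak by (intro sum.cong refl) (simp add: integral_gauss_index_product[OF \<sigma>])
  also have "\<dots> = \<sigma>\<^sup>2 * (\<Sum>p<m. X $$ (a, p) * Z $$ (b, p))"
    by (simp add: sum_distrib_left mult_ac)
  finally show "(\<integral>R. (X * to_mat m r R) $$ (a, k) * (Z * to_mat m r R) $$ (b, k) \<partial>?M)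
      = \<sigma>\<^sup>2 * (\<Sum>p<m. X $$ (a, p) * Z $$ (b, p))" .
qed

text \<open>The entry (a, b) of the expectation of V(G) G^T.\<close>

definition polar_gram :: "nat \<Rightarrow> nat \<Rightarrow> real \<Rightarrow> nat \<Rightarrow> nat \<Rightarrow> real" where
  "polar_gram d r \<sigma> a b = (\<integral>G. (\<Sum>k<r. newton_schulz_limit d r (to_mat d r G) $$ (a, k) * to_mat d r G $$ (b, k))
     \<partial>gauss_index \<sigma> (mat_index d r))"

text \<open>For a signed permutation matrix D, the matrix D G has the law of G and V(D G) = D V(G),
  so the expectation M of V(G) G^T satisfies M = D M D^T. The statement is this identity read
  entrywise.\<close>

lemma polar_gram_signed_permutation:
  assumes dr: "d \<le> r" and \<sigma>: "\<sigma> > 0" and \<pi>: "\<pi> permutes {..<d}" and e: "\<And>i. e i = 1 \<or> e i = (- 1 :: real)"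
    and ab: "a < d" "b < d"
  shows "polar_gram d r \<sigma> a b = e a * e b * polar_gram d r \<sigma> (\<pi> a) (\<pi> b)"
proof -
  let ?P = "newton_schulz_limit d r" and ?M = "gauss_index \<sigma> (mat_index d r)"
  \<comment> \<open>Row i carries \<open>e i\<close> in column \<open>\<pi> i\<close>, so row i of D
    Y is \<open>e i\<close> times row \<open>\<pi> i\<close> of Y.\<close>
  define D where "D = mat d d (\<lambda>(i, j). if j = \<pi> i then e i else 0)"
  have \<pi>d: "i < d \<Longrightarrow> \<pi> i < d" for i using permutes_in_image[OF \<pi>, of i] by simp
  have Dc: "D \<in> carrier_mat d d" by (simp add: D_def)
  have Dmult: "(D * Y) $$ (i, k) = e i * Y $$ (\<pi> i, k)" if "Y \<in> carrier_mat d c" "i < d" "k < c" for Y i k c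
  proof -
    have "(D * Y) $$ (i, k) = (\<Sum>j<d. if j = \<pi> i then e i * Y $$ (j, k) else 0)"
      unfolding index_mult_mat_sum[OF Dc that] using that by (intro sum.cong) (auto simp: D_def)
    then show ?thesis using \<pi>d[OF that(2)] by simp
  qed
  have DD: "D * transpose_mat D = 1\<^sub>m d"
  proof (rule eq_matI)
    fix i j assume "i < dim_row (1\<^sub>m d :: real mat)" "j < dim_col (1\<^sub>m d :: real mat)"
    then have ij: "i < d" "j < d" by auto
    have "(D * transpose_mat D) $$ (i, j) = e i * D $$ (j, \<pi> i)"
      using Dmult[of "transpose_mat D" d i j] ij Dc \<pi>d by simp
    also have "\<dots> = (if i = j then 1 else 0)"
      using ij \<pi>d e[of i] permutes_inj[OF \<pi>] by (auto simp: D_def inj_eq)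
    finally show "(D * transpose_mat D) $$ (i, j) = 1\<^sub>m d $$ (i, j)" using ij by simp
  qed (use Dc in auto)
  have DD': "transpose_mat D * D = 1\<^sub>m d"
    by (rule mat_mult_left_right_inverse[OF Dc _ DD]) (use Dc in simp)
  define h where "h = (\<lambda>a b Y. \<Sum>k<r. ?P Y $$ (a, k) * Y $$ (b, k))"
  have one: "1\<^sub>m d * to_mat d r G = to_mat d r G" for G by (rule left_mult_one_mat[OF to_mat_carrier])
  have h_meas: "(\<lambda>G. h a b (to_mat d r G)) \<in> borel_measurable ?M" if "a < d" "b < d" for a b
    unfolding h_def using that measurable_polar_gauss[OF one_carrier_mat, of a d _ r \<sigma>]
      measurable_mult_to_mat[OF one_carrier_mat, of b d _ r \<sigma>]
    by (intro borel_measurable_sum borel_measurable_times) (auto simp: one)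
  have "polar_gram d r \<sigma> a b = (\<integral>G. h a b (D * to_mat d r G) \<partial>?M)"
    unfolding integral_gauss_mult_orthonormal[OF Dc DD \<sigma> h_meas[OF ab]] by (simp add: polar_gram_def h_def)
  also have "\<dots> = (\<integral>G. e a * e b * h (\<pi> a) (\<pi> b) (to_mat d r G) \<partial>?M)"
  proof (rule integral_cong_AE)
    have "D * to_mat d r G = to_mat d r (mat_entries d r (D * to_mat d r G))" for G
      by (rule to_mat_mat_entries[symmetric]) (rule mult_carrier_mat[OF Dc to_mat_carrier])
    then show "(\<lambda>G. h a b (D * to_mat d r G)) \<in> borel_measurable ?M"
      using measurable_compose[OF distr_gauss_mult_orthonormal(2)[OF Dc DD \<sigma>] h_meas[OF ab]] by simp
    show "(\<lambda>G. e a * e b * h (\<pi> a) (\<pi> b) (to_mat d r G)) \<in> borel_measurable ?M"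
      using h_meas \<pi>d ab by simp
    show "AE G in ?M. h a b (D * to_mat d r G) = e a * e b * h (\<pi> a) (\<pi> b) (to_mat d r G)"
      using AE_gauss_matrix_svd[OF dr \<sigma>]
    proof eventually_elim
      case (elim G)
      then obtain U s E where S: "svd d r (to_mat d r G) U s E" by blast
      have "?P (D * to_mat d r G) = D * U * E"
        by (rule newton_schulz_limit_svd[OF svd_left_orthogonal[OF S Dc DD DD']])
      also have "\<dots> = D * ?P (to_mat d r G)"
        unfolding newton_schulz_limit_svd[OF S] by (rule assoc_mult_mat[OF Dc svdD(1,5)[OF S]])
      finally have P: "?P (D * to_mat d r G) = D * ?P (to_mat d r G)" .
      have Pc: "?P (to_mat d r G) \<in> carrier_mat d r" by (simp add: newton_schulz_limit_def)
      show ?case unfolding h_def P sum_distrib_left using ab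
        by (intro sum.cong refl) (simp add: Dmult[OF Pc] Dmult[OF to_mat_carrier] mult_ac)
    qed
  qed
  also have "\<dots> = e a * e b * polar_gram d r \<sigma> (\<pi> a) (\<pi> b)"
    by (simp add: polar_gram_def h_def)
  finally show ?thesis .
qed

lemma polar_gram_eq_alpha:
  assumes d: "1 \<le> d" and dr: "d \<le> r" and ab: "a < d" "b < d"
  shows "polar_gram d r (sqrt (1 / real r)) a b = (if a = b then alpha_R d r else 0)"
proof -
  let ?\<sigma> = "sqrt (1 / real r)" and ?P = "newton_schulz_limit d r"
  let ?M = "gauss_index ?\<sigma> (mat_index d r)"
  have \<sigma>: "?\<sigma> > 0" using d dr by simp
  \<comment> \<open>Flipping the sign of row a alone negates an off-diagonal entry in that
    row.\<close>
  have off: "polar_gram d r ?\<sigma> a b = 0" if "a < d" "b < d" "a \<noteq> b" for a b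
    using polar_gram_signed_permutation[OF dr \<sigma> permutes_id, of "\<lambda>i. if i = a then - 1 else 1" a b] that by simp
  \<comment> \<open>Transposing rows a and b exchanges the two diagonal entries.\<close>
  have diag: "polar_gram d r ?\<sigma> a a = polar_gram d r ?\<sigma> b b" if "a < d" "b < d" for a b
    using polar_gram_signed_permutation[OF dr \<sigma> permutes_swap_id, of a b "\<lambda>_. 1" a a] that by simp
  have int: "integrable ?M (\<lambda>G. ?P (to_mat d r G) $$ (a, k) * to_mat d r G $$ (b, k))" if "a < d" "b < d" "k < r" for a b k
    using integrable_polar_times[OF dr \<sigma> one_carrier_mat _ that(1,3) integrable_mult_to_mat[OF \<sigma> one_carrier_mat that(2,3)]]
    by (simp add: left_mult_one_mat[OF to_mat_carrier])
  \<comment> \<open>The trace of V(G) G^T divided by d, a measurable representative of the integrand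
    of \<open>alpha_R\<close>.\<close>
  define h where "h = (\<lambda>G. 1 / real d * (\<Sum>a<d. \<Sum>k<r. ?P (to_mat d r G) $$ (a, k) * to_mat d r G $$ (a, k)))"
  have hint: "integrable ?M h"
    unfolding h_def by (intro integrable_mult_right Bochner_Integration.integrable_sum int) auto
  have "alpha_R d r = (\<integral>G. h G \<partial>?M)"
    unfolding alpha_R_def gauss_entries_def
  proof (rule integral_completion_AE)
    show "h \<in> borel_measurable ?M" using hint by (rule borel_measurable_integrable)
    show "AE G in ?M. 1 / real d * sum_mset (singular_values (to_mat d r G)) = h G"
      using AE_gauss_matrix_svd[OF dr \<sigma>]
    proof eventually_elim
      case (elim G)
      then obtain U s E where S: "svd d r (to_mat d r G) U s E" by blast
      have UE: "U * E \<in> carrier_mat d r" using svdD[OF S] by simp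
      have T: "transpose_mat (to_mat d r G) \<in> carrier_mat r d" by simp
      have "sum_mset (singular_values (to_mat d r G)) = (\<Sum>a<d. (U * E * transpose_mat (to_mat d r G)) $$ (a, a))"
        unfolding trace_polar_svd[OF S] by (rule sum_singular_values_svd[OF S])
      also have "\<dots> = (\<Sum>a<d. \<Sum>k<r. (U * E) $$ (a, k) * to_mat d r G $$ (a, k))"
        by (intro sum.cong refl, subst index_mult_mat_sum[OF UE T]) (auto simp: to_mat_def)
      finally show ?case unfolding h_def newton_schulz_limit_svd[OF S] by simp
    qed
  qed
  also have "\<dots> = 1 / real d * (\<Sum>a<d. polar_gram d r ?\<sigma> a a)"
    unfolding h_def polar_gram_def integral_mult_right_zero
    by (intro arg_cong2[where f="(*)"] refl Bochner_Integration.integral_sum Bochner_Integration.integrable_sum int) auto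
  also have "(\<Sum>c<d. polar_gram d r ?\<sigma> c c) = (\<Sum>c<d. polar_gram d r ?\<sigma> a a)"
    by (intro sum.cong refl, rule diag) (use ab in auto)
  finally have "alpha_R d r = polar_gram d r ?\<sigma> a a" using d by simp
  then show ?thesis using off ab by auto
qed

lemma integral_polar_orthogonal_zero:
  assumes dr: "d \<le> r" and \<sigma>: "\<sigma> > 0" and X: "X \<in> carrier_mat d m" "X * transpose_mat X = 1\<^sub>m d"
    and W: "W \<in> carrier_mat d m" "W * transpose_mat X = 0\<^sub>m d d" and ab: "a < d" "b < d"
  shows "(\<integral>R. (\<Sum>k<r. newton_schulz_limit d r (X * to_mat m r R) $$ (a, k) * (W * to_mat m r R) $$ (b, k))
     \<partial>gauss_index \<sigma> (mat_index m r)) = 0"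
proof -
  let ?P = "newton_schulz_limit d r" and ?M = "gauss_index \<sigma> (mat_index m r)"
  let ?X = "transpose_mat X"
  have X': "?X \<in> carrier_mat m d" using X by simp
  define H where "H = 2 \<cdot>\<^sub>m (?X * X) - 1\<^sub>m m"
  have Hc: "H \<in> carrier_mat m m" unfolding H_def by (rule minus_carrier_mat[OF one_carrier_mat])
  have XXc: "?X * X \<in> carrier_mat m m" using X by simp
  \<comment> \<open>With A X^T known, this determines A H. It is applied to A = X, where A X^T = 1,
    to A = W, where it is 0, and finally to A = H, where it is X^T.\<close>
  have AH: "A * H = 2 \<cdot>\<^sub>m (A * ?X * X) - A" if "A \<in> carrier_mat c m" for A c
    unfolding H_def using that X XXc
    by (simp add: mult_minus_distrib_mat[of A c m _ m] mult_smult_distrib[of A c m _ m] assoc_mult_mat[OF that X' X(1)])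
  have XH: "X * H = X"
    unfolding AH[OF X(1)] X(2) using X(1) by (intro eq_matI) auto
  have WH: "W * H = - W"
    unfolding AH[OF W(1)] W(2) using W(1) X(1) by (intro eq_matI) auto
  have "transpose_mat H = H"
  proof (rule eq_matI)
    have t: "transpose_mat (?X * X) = ?X * X" using transpose_mult[OF X' X(1)] by simp
    fix i j assume "i < dim_row H" "j < dim_col H"
    then have ij: "i < m" "j < m" using Hc by auto
    have "(?X * X) $$ (j, i) = (?X * X) $$ (i, j)"
      using arg_cong[OF t, of "\<lambda>M. M $$ (i, j)"] ij X(1) by simp
    then show "transpose_mat H $$ (i, j) = H $$ (i, j)"
      unfolding H_def using ij XXc by (auto simp del: index_mult_mat(1))
  qed (use Hc in auto)
  moreover have "H * H = 1\<^sub>m m"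
  proof -
    have "H * ?X = ?X"
    proof -
      have "transpose_mat (X * H) = H * ?X"
        using transpose_mult[OF X(1) Hc] \<open>transpose_mat H = H\<close> by simp
      then show ?thesis unfolding XH by simp
    qed
    then have "H * H = 2 \<cdot>\<^sub>m (?X * X) - H" unfolding AH[OF Hc] by simp
    then show ?thesis using X(1) XXc unfolding H_def by (intro eq_matI) (auto simp del: index_mult_mat(1))
  qed
  ultimately have HH: "H * transpose_mat H = 1\<^sub>m m" by simp
  define h where "h = (\<lambda>Y. \<Sum>k<r. ?P (X * Y) $$ (a, k) * (W * Y) $$ (b, k))"
  have h_meas: "(\<lambda>R. h (to_mat m r R)) \<in> borel_measurable ?M"
    unfolding h_def using ab
    by (intro borel_measurable_sum borel_measurable_times measurable_polar_gauss[OF X(1)] measurable_mult_to_mat[OF W(1)]) auto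
  have "h (H * to_mat m r R) = - h (to_mat m r R)" for R
  proof -
    have "X * (H * to_mat m r R) = X * to_mat m r R" "W * (H * to_mat m r R) = - W * to_mat m r R"
      using assoc_mult_mat[OF X(1) Hc to_mat_carrier, of r R] assoc_mult_mat[OF W(1) Hc to_mat_carrier, of r R]
      by (simp_all add: XH WH)
    moreover have "(- W * to_mat m r R) $$ (b, k) = - (W * to_mat m r R) $$ (b, k)" if "k < r" for k
      using that ab W(1) index_mult_to_mat[of "- W" d m b k r R] index_mult_to_mat[OF W(1) ab(2) that]
      by (simp add: sum_negf)
    ultimately show ?thesis unfolding h_def by (simp add: sum_negf del: index_mult_mat(1))
  qed
  \<comment> \<open>R and H R have the same law and h is odd under H, so the integral is its own
    negative.\<close>
  then have "(\<integral>R. h (to_mat m r R) \<partial>?M) = - (\<integral>R. h (to_mat m r R) \<partial>?M)"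
    using integral_gauss_mult_orthonormal[OF Hc HH \<sigma> h_meas] by simp
  then show ?thesis by (simp add: h_def)
qed

text \<open>Split Z = B X + W with B = Z X^T, so that W X^T = 0. The W part has zero correlation
  with V(X R) by reflection. In the B X part, X R is a Gaussian d x r matrix, so the expectation of
  V(X R) (X R)^T is alpha times the identity, and alpha B^T = alpha X Z^T remains.\<close>

lemma integral_polar_cross:
  assumes d: "1 \<le> d" and dr: "d \<le> r" and X: "X \<in> carrier_mat d m" "X * transpose_mat X = 1\<^sub>m d"
    and Z: "Z \<in> carrier_mat d m" and ab: "a < d" "b < d"
  shows "(\<integral>R. (\<Sum>k<r. newton_schulz_limit d r (X * to_mat m r R) $$ (a, k) * (Z * to_mat m r R) $$ (b, k))
     \<partial>gauss_index (sqrt (1 / real r)) (mat_index m r)) = alpha_R d r * (\<Sum>p<m. X $$ (a, p) * Z $$ (b, p))"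
proof -
  let ?\<sigma> = "sqrt (1 / real r)"
  let ?P = "newton_schulz_limit d r" and ?M = "gauss_index ?\<sigma> (mat_index m r)"
  have \<sigma>: "?\<sigma> > 0" using d dr by simp
  have X': "transpose_mat X \<in> carrier_mat m d" using X by simp
  define B where "B = Z * transpose_mat X"
  define W where "W = Z - B * X"
  have B: "B \<in> carrier_mat d d" using Z X by (simp add: B_def)
  have BX: "B * X \<in> carrier_mat d m" using B X by simp
  have W: "W \<in> carrier_mat d m" unfolding W_def by (rule minus_carrier_mat[OF BX])
  have WX: "W * transpose_mat X = 0\<^sub>m d d"
  proof -
    have "W * transpose_mat X = Z * transpose_mat X - B * X * transpose_mat X"
      unfolding W_def by (rule minus_mult_distrib_mat[OF Z BX X'])
    also have "B * X * transpose_mat X = B" using assoc_mult_mat[OF B X(1) X'] X(2) B by simp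
    finally show ?thesis using B by (simp add: B_def)
  qed
  let ?p = "\<lambda>R a k. ?P (X * to_mat m r R) $$ (a, k)" and ?x = "\<lambda>R c k. (X * to_mat m r R) $$ (c, k)"
    and ?w = "\<lambda>R k. (W * to_mat m r R) $$ (b, k)"
  have dec: "(Z * to_mat m r R) $$ (b, k) = (\<Sum>c<d. B $$ (b, c) * ?x R c k) + ?w R k" if k: "k < r" for R k
  proof -
    have "(B * X * to_mat m r R) $$ (b, k) = (B * (X * to_mat m r R)) $$ (b, k)"
      using assoc_mult_mat[OF B X(1) to_mat_carrier] by simp
    also have "\<dots> = (\<Sum>c<d. B $$ (b, c) * ?x R c k)"
      by (rule index_mult_mat_sum[OF B mult_carrier_mat[OF X(1) to_mat_carrier] ab(2) k])
    finally have 1: "(B * X * to_mat m r R) $$ (b, k) = (\<Sum>c<d. B $$ (b, c) * ?x R c k)" .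
    have "?w R k = (Z * to_mat m r R) $$ (b, k) - (B * X * to_mat m r R) $$ (b, k)"
      unfolding W_def minus_mult_distrib_mat[OF Z BX to_mat_carrier]
      using carrier_matD[OF B] carrier_matD[OF to_mat_carrier[of m r R]] ab k by (auto simp del: index_mult_mat(1))
    then show ?thesis using 1 by simp
  qed
  have int_x: "integrable ?M (\<lambda>R. ?p R a k * ?x R c k)" if "k < r" "c < d" for k c
    by (intro integrable_polar_times[OF dr \<sigma> X ab(1)] integrable_mult_to_mat[OF \<sigma> X(1)] that)
  have int_w: "integrable ?M (\<lambda>R. ?p R a k * ?w R k)" if "k < r" for k
    by (intro integrable_polar_times[OF dr \<sigma> X ab(1)] integrable_mult_to_mat[OF \<sigma> W] that ab)
  have xint: "(\<integral>R. (\<Sum>k<r. ?p R a k * ?x R c k) \<partial>?M) = (if a = c then alpha_R d r else 0)" if c: "c < d" for c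
  proof -
    define h where "h = (\<lambda>Y. \<Sum>k<r. ?P Y $$ (a, k) * Y $$ (c, k))"
    have one: "1\<^sub>m d * to_mat d r G = to_mat d r G" for G by (rule left_mult_one_mat[OF to_mat_carrier])
    have h_meas: "(\<lambda>G. h (to_mat d r G)) \<in> borel_measurable (gauss_index ?\<sigma> (mat_index d r))"
      unfolding h_def using ab(1) c measurable_polar_gauss[OF one_carrier_mat, of a d _ r ?\<sigma>]
        measurable_mult_to_mat[OF one_carrier_mat, of c d _ r ?\<sigma>]
      by (intro borel_measurable_sum borel_measurable_times) (auto simp: one)
    have "(\<integral>R. h (X * to_mat m r R) \<partial>?M) = polar_gram d r ?\<sigma> a c"
      unfolding integral_gauss_mult_orthonormal[OF X \<sigma> h_meas] by (simp add: polar_gram_def h_def)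
    then show ?thesis using polar_gram_eq_alpha[OF d dr ab(1) c] by (simp add: h_def)
  qed
  have int_xs: "integrable ?M (\<lambda>R. \<Sum>k<r. ?p R a k * ?x R c k)" if "c < d" for c
    by (intro Bochner_Integration.integrable_sum int_x) (use that in auto)
  have int_ws: "integrable ?M (\<lambda>R. \<Sum>k<r. ?p R a k * ?w R k)"
    by (intro Bochner_Integration.integrable_sum int_w) auto
  have "(\<Sum>k<r. ?p R a k * (Z * to_mat m r R) $$ (b, k))
      = (\<Sum>c<d. B $$ (b, c) * (\<Sum>k<r. ?p R a k * ?x R c k)) + (\<Sum>k<r. ?p R a k * ?w R k)" for R
  proof -
    have "(\<Sum>k<r. ?p R a k * (Z * to_mat m r R) $$ (b, k))
      = (\<Sum>k<r. (\<Sum>c<d. B $$ (b, c) * (?p R a k * ?x R c k)) + ?p R a k * ?w R k)"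
      by (intro sum.cong refl) (simp add: dec distrib_left sum_distrib_left mult_ac del: index_mult_mat(1))
    also have "\<dots> = (\<Sum>c<d. \<Sum>k<r. B $$ (b, c) * (?p R a k * ?x R c k)) + (\<Sum>k<r. ?p R a k * ?w R k)"
      unfolding sum.distrib by (subst sum.swap) simp
    finally show ?thesis by (simp add: sum_distrib_left)
  qed
  then have "(\<integral>R. (\<Sum>k<r. ?p R a k * (Z * to_mat m r R) $$ (b, k)) \<partial>?M)
     = (\<integral>R. (\<Sum>c<d. B $$ (b, c) * (\<Sum>k<r. ?p R a k * ?x R c k)) + (\<Sum>k<r. ?p R a k * ?w R k) \<partial>?M)"
    by (simp only:)
  also have "\<dots> = (\<integral>R. (\<Sum>c<d. B $$ (b, c) * (\<Sum>k<r. ?p R a k * ?x R c k)) \<partial>?M)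
      + (\<integral>R. (\<Sum>k<r. ?p R a k * ?w R k) \<partial>?M)"
    by (intro Bochner_Integration.integral_add int_ws Bochner_Integration.integrable_sum integrable_mult_right int_xs) auto
  also have "(\<integral>R. (\<Sum>c<d. B $$ (b, c) * (\<Sum>k<r. ?p R a k * ?x R c k)) \<partial>?M)
      = (\<Sum>c<d. (\<integral>R. B $$ (b, c) * (\<Sum>k<r. ?p R a k * ?x R c k) \<partial>?M))"
    by (intro Bochner_Integration.integral_sum integrable_mult_right int_xs) auto
  also have "\<dots> = (\<Sum>c<d. if a = c then B $$ (b, c) * alpha_R d r else 0)"
    by (intro sum.cong refl) (simp add: xint del: index_mult_mat(1))
  also have "\<dots> = B $$ (b, a) * alpha_R d r" using ab by simp
  also have "(\<integral>R. (\<Sum>k<r. ?p R a k * ?w R k) \<partial>?M) = 0"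
    by (rule integral_polar_orthogonal_zero[OF dr \<sigma> X W WX ab])
  also have "B $$ (b, a) = (\<Sum>p<m. X $$ (a, p) * Z $$ (b, p))"
    unfolding B_def index_mult_mat_sum[OF Z X' ab(2) ab(1)] using X(1) ab
    by (intro sum.cong) (auto simp: mult.commute)
  finally show ?thesis by (simp add: mult.commute)
qed

subsection \<open>The rounding bound\<close>

lemma sum_blocks:
  fixes f :: "nat \<Rightarrow> real"
  shows "(\<Sum>p<n * d. f p) = (\<Sum>i<n. \<Sum>a<d. f (i * d + a))"
proof -
  have "(\<Sum>p<n * d. f p) = (\<Sum>i<n. sum f {i * d..<i * d + d})" by (rule sum.nat_group[symmetric])
  also have "\<dots> = (\<Sum>i<n. \<Sum>a<d. f (i * d + a))"
    by (simp add: sum.atLeastLessThan_shift_0 atLeast0LessThan comp_def)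
  finally show ?thesis .
qed

lemma block_index_less: "i < n \<Longrightarrow> a < d \<Longrightarrow> i * d + a < n * (d :: nat)"
  by (metis div_less_iff_less_mult div_mult_self3 div_less add.right_neutral gr_implies_not0 gr0I)

text \<open>The objective depends on the matrices only through their pairwise row inner products.
  This allows points with r columns and points with \<open>n * d\<close> columns to be
  compared.\<close>

lemma obj_eq_sum:
  assumes Y: "\<And>i. i < n \<Longrightarrow> Y i \<in> carrier_mat d m"
  shows "obj n d C Y = (\<Sum>i<n. \<Sum>j<n. \<Sum>a<d. \<Sum>b<d.
    C $$ (i * d + a, j * d + b) * (\<Sum>k<m. Y i $$ (a, k) * Y j $$ (b, k)))"
  unfolding obj_def
proof (intro sum.cong refl)
  fix i j assume "i \<in> {..<n}" "j \<in> {..<n}"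
  then have Yi: "Y i \<in> carrier_mat d m" and Yj: "transpose_mat (Y j) \<in> carrier_mat m d" "Y j \<in> carrier_mat d m"
    using Y by auto
  let ?B = "transpose_mat (blk d C i j)"
  have B: "?B \<in> carrier_mat d d" by (simp add: blk_def)
  have BY: "?B * Y i \<in> carrier_mat d m" using B Yi by simp
  have "mtrace (?B * Y i * transpose_mat (Y j)) = (\<Sum>b<d. (?B * Y i * transpose_mat (Y j)) $$ (b, b))"
    unfolding mtrace_def using B by simp
  also have "\<dots> = (\<Sum>b<d. \<Sum>k<m. \<Sum>a<d. C $$ (i * d + a, j * d + b) * (Y i $$ (a, k) * Y j $$ (b, k)))"
  proof (intro sum.cong refl)
    fix b assume "b \<in> {..<d}"
    then have b: "b < d" by simp
    have "(?B * Y i * transpose_mat (Y j)) $$ (b, b) = (\<Sum>k<m. (?B * Y i) $$ (b, k) * transpose_mat (Y j) $$ (k, b))"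
      by (rule index_mult_mat_sum[OF BY Yj(1) b b])
    also have "\<dots> = (\<Sum>k<m. (\<Sum>a<d. ?B $$ (b, a) * Y i $$ (a, k)) * Y j $$ (b, k))"
      using b Yj by (intro sum.cong refl) (simp add: index_mult_mat_sum[OF B Yi b] del: index_mult_mat(1))
    also have "\<dots> = (\<Sum>k<m. \<Sum>a<d. C $$ (i * d + a, j * d + b) * (Y i $$ (a, k) * Y j $$ (b, k)))"
      unfolding sum_distrib_right using b by (intro sum.cong refl) (simp add: blk_def)
    finally show "(?B * Y i * transpose_mat (Y j)) $$ (b, b)
      = (\<Sum>k<m. \<Sum>a<d. C $$ (i * d + a, j * d + b) * (Y i $$ (a, k) * Y j $$ (b, k)))" .
  qed
  also have "\<dots> = (\<Sum>b<d. \<Sum>a<d. C $$ (i * d + a, j * d + b) * (\<Sum>k<m. Y i $$ (a, k) * Y j $$ (b, k)))"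
    unfolding sum_distrib_left by (intro sum.cong refl sum.swap)
  also have "\<dots> = (\<Sum>a<d. \<Sum>b<d. C $$ (i * d + a, j * d + b) * (\<Sum>k<m. Y i $$ (a, k) * Y j $$ (b, k)))"
    by (rule sum.swap)
  finally show "mtrace (?B * Y i * transpose_mat (Y j))
    = (\<Sum>a<d. \<Sum>b<d. C $$ (i * d + a, j * d + b) * (\<Sum>k<m. Y i $$ (a, k) * Y j $$ (b, k)))" .
qed

text \<open>For each fixed k the entries \<open>x i a k\<close>, stacked at positions
  \<open>i * d + a\<close>, form a vector v, and the contribution of k is the quadratic form of C at
  v. The inner sum over k adds up m such forms.\<close>

lemma psd_block_form_nonneg:
  fixes x :: "nat \<Rightarrow> nat \<Rightarrow> nat \<Rightarrow> real"
  assumes C: "psd (n * d) C"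
  shows "0 \<le> (\<Sum>i<n. \<Sum>j<n. \<Sum>a<d. \<Sum>b<d. C $$ (i * d + a, j * d + b) * (\<Sum>k<m. x i a k * x j b k))"
proof -
  have Cc: "C \<in> carrier_mat (n * d) (n * d)" using C by (simp add: psd_def)
  have nonneg: "0 \<le> (\<Sum>i<n. \<Sum>a<d. \<Sum>j<n. \<Sum>b<d. x i a k * (C $$ (i * d + a, j * d + b) * x j b k))" for k
  proof -
    define v where "v = vec (n * d) (\<lambda>p. x (p div d) (p mod d) k)"
    have v: "v \<in> carrier_vec (n * d)" by (simp add: v_def)
    have vi: "v $ (i * d + a) = x i a k" if "i < n" "a < d" for i a
      using block_index_less[OF that] that by (simp add: v_def)
    have "v \<bullet> (C *\<^sub>v v) = (\<Sum>p<n * d. v $ p * (\<Sum>q<n * d. C $$ (p, q) * v $ q))"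
      using Cc v by (auto simp: scalar_prod_def atLeast0LessThan intro!: sum.cong)
    also have "\<dots> = (\<Sum>i<n. \<Sum>a<d. \<Sum>j<n. \<Sum>b<d. x i a k * (C $$ (i * d + a, j * d + b) * x j b k))"
      unfolding sum_blocks by (intro sum.cong refl) (simp add: vi sum_distrib_left)
    finally have "v \<bullet> (C *\<^sub>v v) = (\<Sum>i<n. \<Sum>a<d. \<Sum>j<n. \<Sum>b<d. x i a k * (C $$ (i * d + a, j * d + b) * x j b k))" .
    moreover have "0 \<le> v \<bullet> (C *\<^sub>v v)" using C v by (simp add: psd_def)
    ultimately show ?thesis by linarith
  qed
  have "(\<Sum>i<n. \<Sum>j<n. \<Sum>a<d. \<Sum>b<d. C $$ (i * d + a, j * d + b) * (\<Sum>k<m. x i a k * x j b k))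
    = (\<Sum>i<n. \<Sum>j<n. \<Sum>a<d. \<Sum>b<d. \<Sum>k<m. x i a k * (C $$ (i * d + a, j * d + b) * x j b k))"
    unfolding sum_distrib_left by (intro sum.cong refl) (simp add: mult_ac)
  also have "\<dots> = (\<Sum>i<n. \<Sum>a<d. \<Sum>j<n. \<Sum>b<d. \<Sum>k<m. x i a k * (C $$ (i * d + a, j * d + b) * x j b k))"
    by (rule sum.cong[OF refl]) (rule sum.swap)
  also have "\<dots> = (\<Sum>k<m. \<Sum>i<n. \<Sum>a<d. \<Sum>j<n. \<Sum>b<d. x i a k * (C $$ (i * d + a, j * d + b) * x j b k))"
    by (simp only: sum.swap[where B="{..<m}"])
  also have "\<dots> \<ge> 0" by (intro sum_nonneg nonneg)
  finally show ?thesis .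
qed

text \<open>L = U diag(sqrt l), where l is nonnegative because its entries are squared row lengths
  of U^T Y.\<close>

lemma gram_factor:
  fixes Y :: "real mat"
  assumes Y: "Y \<in> carrier_mat m r"
  shows "\<exists>L \<in> carrier_mat m m. L * transpose_mat L = Y * transpose_mat Y"
proof -
  obtain U l where U: "U \<in> carrier_mat m m" and YU: "Y * transpose_mat Y = U * mat_diag m l * transpose_mat U"
     and l: "\<And>k. k < m \<Longrightarrow> l k = (\<Sum>j<r. ((transpose_mat U * Y) $$ (k, j))\<^sup>2)"
    using gram_spectral[OF Y] by metis
  let ?D = "mat_diag m (\<lambda>k. sqrt (l k))"
  have UD: "U * ?D \<in> carrier_mat m m" by (rule mult_carrier_mat[OF U mat_diag_dim])
  have "U * ?D * transpose_mat (U * ?D) = U * mat_diag m (\<lambda>k. sqrt (l k) * sqrt (l k)) * transpose_mat U"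
    \<comment> \<open>The factor E is taken to be the identity.\<close>
    using diag_sandwich_mult_transpose[OF U, of "1\<^sub>m m" m "\<lambda>k. sqrt (l k)" "\<lambda>k. sqrt (l k)"]
      right_mult_one_mat[OF UD] by simp
  also have "mat_diag m (\<lambda>k. sqrt (l k) * sqrt (l k)) = mat_diag m l"
    by (intro mat_diag_cong) (simp add: l sum_nonneg)
  finally show ?thesis using UD YU by metis
qed

text \<open>Constraints and objective involve only the Gram matrix of the stacked blocks S. A square
  factor L of it has exactly the \<open>n * d\<close> columns of the relaxation, and its row blocks
  serve as Y. Going through the Gram matrix treats r below and above \<open>n * d\<close> alike,
  whereas padding with zero columns would require r to be at most \<open>n * d\<close>.\<close>

lemma stiefel_obj_realized:
  assumes Q: "\<And>i. i < n \<Longrightarrow> Q i \<in> stiefel d r"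
  obtains Y where "\<And>i. i < n \<Longrightarrow> Y i \<in> carrier_mat d (n * d) \<and> Y i * transpose_mat (Y i) = 1\<^sub>m d"
    "obj n d C Y = obj n d C Q"
proof -
  have Qc: "\<And>i. i < n \<Longrightarrow> Q i \<in> carrier_mat d r" using Q by (auto simp: stiefel_def)
  define S where "S = mat (n * d) r (\<lambda>(p, k). Q (p div d) $$ (p mod d, k))"
  have S: "S \<in> carrier_mat (n * d) r" "transpose_mat S \<in> carrier_mat r (n * d)" by (auto simp: S_def)
  obtain L where L: "L \<in> carrier_mat (n * d) (n * d)" "L * transpose_mat L = S * transpose_mat S"
    using gram_factor[OF S(1)] by blast
  have L': "transpose_mat L \<in> carrier_mat (n * d) (n * d)" using L by simp
  define Y where "Y = (\<lambda>i. mat d (n * d) (\<lambda>(a, c). L $$ (i * d + a, c)))"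
  have Yc: "Y i \<in> carrier_mat d (n * d)" for i by (simp add: Y_def)
  have gram: "(\<Sum>c<n * d. Y i $$ (a, c) * Y j $$ (b, c)) = (\<Sum>k<r. Q i $$ (a, k) * Q j $$ (b, k))"
    if ij: "i < n" "j < n" "a < d" "b < d" for i j a b
  proof -
    note p = block_index_less[OF ij(1,3)] and q = block_index_less[OF ij(2,4)]
    have "(\<Sum>c<n * d. Y i $$ (a, c) * Y j $$ (b, c)) = (\<Sum>c<n * d. L $$ (i * d + a, c) * transpose_mat L $$ (c, j * d + b))"
      using ij L(1) p q by (intro sum.cong) (auto simp: Y_def)
    also have "\<dots> = (L * transpose_mat L) $$ (i * d + a, j * d + b)"
      by (rule index_mult_mat_sum[OF L(1) L' p q, symmetric])
    also have "\<dots> = (\<Sum>k<r. S $$ (i * d + a, k) * transpose_mat S $$ (k, j * d + b))"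
      unfolding L(2) by (rule index_mult_mat_sum[OF S p q])
    also have "\<dots> = (\<Sum>k<r. Q i $$ (a, k) * Q j $$ (b, k))"
      using ij p q by (intro sum.cong refl) (simp add: S_def)
    finally show ?thesis .
  qed
  have "Y i * transpose_mat (Y i) = 1\<^sub>m d" if i: "i < n" for i
  proof (rule eq_matI)
    fix a b assume "a < dim_row (1\<^sub>m d :: real mat)" "b < dim_col (1\<^sub>m d :: real mat)"
    then have ab: "a < d" "b < d" by auto
    have Yt: "transpose_mat (Y i) \<in> carrier_mat (n * d) d" and Qt: "transpose_mat (Q i) \<in> carrier_mat r d"
      using Yc Qc[OF i] by auto
    have "(Y i * transpose_mat (Y i)) $$ (a, b) = (\<Sum>c<n * d. Y i $$ (a, c) * Y i $$ (b, c))"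
      unfolding index_mult_mat_sum[OF Yc Yt ab] using ab carrier_matD[OF Yc[of i]] by (intro sum.cong) auto
    also have "\<dots> = (Q i * transpose_mat (Q i)) $$ (a, b)"
      unfolding gram[OF i i ab] index_mult_mat_sum[OF Qc[OF i] Qt ab] using ab Qc[OF i] by (intro sum.cong) auto
    finally show "(Y i * transpose_mat (Y i)) $$ (a, b) = 1\<^sub>m d $$ (a, b)"
      using Q[OF i] by (simp add: stiefel_def)
  qed (use carrier_matD[OF Yc[of i]] in auto)
  moreover have "obj n d C Y = obj n d C Q"
  proof -
    have "obj n d C Q = (\<Sum>i<n. \<Sum>j<n. \<Sum>a<d. \<Sum>b<d.
        C $$ (i * d + a, j * d + b) * (\<Sum>k<r. Q i $$ (a, k) * Q j $$ (b, k)))"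
      by (rule obj_eq_sum) (rule Qc)
    then show ?thesis unfolding obj_eq_sum[of n Y d "n * d", OF Yc]
      by (simp add: gram)
  qed
  ultimately show ?thesis using Yc by (intro that[of Y]) auto
qed

lemma integral_obj_polar_ge:
  fixes C :: "real mat" and X :: "nat \<Rightarrow> real mat"
  assumes d: "1 \<le> d" and dr: "d \<le> r" and C: "psd (n * d) C"
    and X: "\<And>i. i < n \<Longrightarrow> X i \<in> carrier_mat d m" "\<And>i. i < n \<Longrightarrow> X i * transpose_mat (X i) = 1\<^sub>m d"
  shows "(\<integral>R. obj n d C (\<lambda>i. newton_schulz_limit d r (X i * to_mat m r R)) \<partial>gauss_index (sqrt (1 / real r)) (mat_index m r))
    \<ge> (alpha_R d r)\<^sup>2 * obj n d C X" (is "?I \<ge> _")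
    and "(\<lambda>R. obj n d C (\<lambda>i. newton_schulz_limit d r (X i * to_mat m r R)))
      \<in> borel_measurable (gauss_index (sqrt (1 / real r)) (mat_index m r))"
proof -
  let ?\<sigma> = "sqrt (1 / real r)" and ?\<alpha> = "alpha_R d r"
  let ?M = "gauss_index ?\<sigma> (mat_index m r)"
  have \<sigma>: "?\<sigma> > 0" and r: "real r > 0" using d dr by auto
  define v where "v = (\<lambda>R i a k. newton_schulz_limit d r (X i * to_mat m r R) $$ (a, k))"
  define y where "y = (\<lambda>R i a k. (X i * to_mat m r R) $$ (a, k))"
  define g where "g = (\<lambda>i a j b. \<Sum>p<m. X i $$ (a, p) * X j $$ (b, p))"
  define c where "c = (\<lambda>i a j b. C $$ (i * d + a, j * d + b))"
  interpret prob_space ?M using \<sigma> by (rule prob_space_gauss_index)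
  have vy: "integrable ?M (\<lambda>R. \<Sum>k<r. v R i a k * y R j b k)"
      "(\<integral>R. (\<Sum>k<r. v R i a k * y R j b k) \<partial>?M) = ?\<alpha> * g i a j b" if "i < n" "j < n" "a < d" "b < d" for i j a b
  proof -
    show "integrable ?M (\<lambda>R. \<Sum>k<r. v R i a k * y R j b k)"
      unfolding v_def y_def using that
      by (intro Bochner_Integration.integrable_sum integrable_polar_times[OF dr \<sigma> X] integrable_mult_to_mat[OF \<sigma> X(1)]) auto
    show "(\<integral>R. (\<Sum>k<r. v R i a k * y R j b k) \<partial>?M) = ?\<alpha> * g i a j b"
      unfolding v_def y_def g_def using that by (intro integral_polar_cross[OF d dr X X(1)]) auto
  qed
  have yy: "integrable ?M (\<lambda>R. \<Sum>k<r. y R i a k * y R j b k)"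
      "(\<integral>R. (\<Sum>k<r. y R i a k * y R j b k) \<partial>?M) = g i a j b" if "i < n" "j < n" "a < d" "b < d" for i j a b
  proof -
    have int: "integrable ?M (\<lambda>R. y R i a k * y R j b k)" if "k < r" for k
      unfolding y_def using that \<open>i < n\<close> \<open>j < n\<close> \<open>a < d\<close> \<open>b < d\<close>
      by (intro integral_mult_to_mat_product(1)[OF \<sigma> X(1) X(1)]) auto
    show "integrable ?M (\<lambda>R. \<Sum>k<r. y R i a k * y R j b k)"
      by (intro Bochner_Integration.integrable_sum int) auto
    have "(\<integral>R. (\<Sum>k<r. y R i a k * y R j b k) \<partial>?M) = (\<Sum>k<r. \<integral>R. y R i a k * y R j b k \<partial>?M)"
      by (intro Bochner_Integration.integral_sum int) auto
    also have "\<dots> = (\<Sum>k<r. ?\<sigma>\<^sup>2 * g i a j b)"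
      unfolding y_def g_def using that by (intro sum.cong refl integral_mult_to_mat_product(2)[OF \<sigma> X(1) X(1)]) auto
    \<comment> \<open>There are r columns, each with variance 1/r.\<close>
    also have "\<dots> = g i a j b" using r by simp
    finally show "(\<integral>R. (\<Sum>k<r. y R i a k * y R j b k) \<partial>?M) = g i a j b" .
  qed
  have vv: "integrable ?M (\<lambda>R. \<Sum>k<r. v R i a k * v R j b k)" if "i < n" "j < n" "a < d" "b < d" for i j a b
  proof (intro Bochner_Integration.integrable_sum)
    fix k assume "k \<in> {..<r}"
    then have "integrable ?M (\<lambda>R. v R j b k * 1)"
      unfolding v_def using that by (intro integrable_polar_times[OF dr \<sigma> X]) auto
    then show "integrable ?M (\<lambda>R. v R i a k * v R j b k)"
      unfolding v_def using that \<open>k \<in> {..<r}\<close> by (intro integrable_polar_times[OF dr \<sigma> X]) auto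
  qed
  have obj_v: "obj n d C (\<lambda>i. newton_schulz_limit d r (X i * to_mat m r R))
     = (\<Sum>i<n. \<Sum>j<n. \<Sum>a<d. \<Sum>b<d. c i a j b * (\<Sum>k<r. v R i a k * v R j b k))" for R
    unfolding v_def c_def by (rule obj_eq_sum) (simp add: newton_schulz_limit_def)
  have int_v: "integrable ?M (\<lambda>R. \<Sum>i<n. \<Sum>j<n. \<Sum>a<d. \<Sum>b<d. c i a j b * (\<Sum>k<r. v R i a k * v R j b k))"
    by (intro Bochner_Integration.integrable_sum integrable_mult_right vv) auto
  then show "(\<lambda>R. obj n d C (\<lambda>i. newton_schulz_limit d r (X i * to_mat m r R))) \<in> borel_measurable ?M"
    unfolding obj_v by (rule borel_measurable_integrable)
  have obj_x: "obj n d C X = (\<Sum>i<n. \<Sum>j<n. \<Sum>a<d. \<Sum>b<d. c i a j b * g i a j b)"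
    unfolding g_def c_def by (rule obj_eq_sum) (rule X(1))
  \<comment> \<open>The Gram entry of alpha y - v, expanded into four pieces whose integrals are
    treated separately. The first mixed term is written with v in front and the index pairs
    exchanged so that \<open>vy\<close> applies to it.\<close>
  let ?q = "\<lambda>R i a j b. ?\<alpha>\<^sup>2 * (\<Sum>k<r. y R i a k * y R j b k) - ?\<alpha> * (\<Sum>k<r. v R j b k * y R i a k)
      - ?\<alpha> * (\<Sum>k<r. v R i a k * y R j b k) + (\<Sum>k<r. v R i a k * v R j b k)"
  have q: "?q R i a j b = (\<Sum>k<r. (?\<alpha> * y R i a k - v R i a k) * (?\<alpha> * y R j b k - v R j b k))" for R i a j b
    unfolding sum_distrib_left sum_subtractf[symmetric] sum.distrib[symmetric]
    by (intro sum.cong refl) (simp add: power2_eq_square algebra_simps)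
  have int_q: "integrable ?M (\<lambda>R. c i a j b * ?q R i a j b)" if "i < n" "j < n" "a < d" "b < d" for i j a b
    using that
    by (intro integrable_mult_right Bochner_Integration.integrable_add Bochner_Integration.integrable_diff vv vy yy)
  have val_q: "(\<integral>R. c i a j b * ?q R i a j b \<partial>?M)
     = - ?\<alpha>\<^sup>2 * (c i a j b * g i a j b) + (\<integral>R. c i a j b * (\<Sum>k<r. v R i a k * v R j b k) \<partial>?M)"
    if "i < n" "j < n" "a < d" "b < d" for i j a b
  proof -
    \<comment> \<open>By this symmetry the two mixed terms have equal integrals, and alpha^2 - 2
      alpha^2 = - alpha^2 remains in front of g.\<close>
    have "g j b i a = g i a j b" unfolding g_def by (simp add: mult.commute)
    then have qint: "(\<integral>R. ?q R i a j b \<partial>?M) = ?\<alpha>\<^sup>2 * g i a j b - ?\<alpha> * (?\<alpha> * g i a j b) - ?\<alpha> * (?\<alpha> * g i a j b)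
        + (\<integral>R. (\<Sum>k<r. v R i a k * v R j b k) \<partial>?M)"
      using that vv vy yy by simp
    show ?thesis unfolding integral_mult_right_zero qint by (simp add: power2_eq_square algebra_simps)
  qed
  have nn: "0 \<le> (\<Sum>i<n. \<Sum>j<n. \<Sum>a<d. \<Sum>b<d. c i a j b * ?q R i a j b)" for R
    unfolding q c_def by (rule psd_block_form_nonneg[OF C, where x="\<lambda>i a k. ?\<alpha> * y R i a k - v R i a k"])
  have "0 \<le> (\<integral>R. (\<Sum>i<n. \<Sum>j<n. \<Sum>a<d. \<Sum>b<d. c i a j b * ?q R i a j b) \<partial>?M)"
    by (rule Bochner_Integration.integral_nonneg) (rule nn)
  also have "\<dots> = (\<Sum>i<n. \<Sum>j<n. \<Sum>a<d. \<Sum>b<d. \<integral>R. c i a j b * ?q R i a j b \<partial>?M)"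
    by (intro integral_sum4 int_q) auto
  also have "\<dots> = (\<Sum>i<n. \<Sum>j<n. \<Sum>a<d. \<Sum>b<d. - ?\<alpha>\<^sup>2 * (c i a j b * g i a j b)
      + (\<integral>R. c i a j b * (\<Sum>k<r. v R i a k * v R j b k) \<partial>?M))"
    by (intro sum.cong refl val_q) auto
  also have "\<dots> = - ?\<alpha>\<^sup>2 * obj n d C X
      + (\<Sum>i<n. \<Sum>j<n. \<Sum>a<d. \<Sum>b<d. \<integral>R. c i a j b * (\<Sum>k<r. v R i a k * v R j b k) \<partial>?M)"
    unfolding obj_x sum.distrib sum_distrib_left ..
  also have "(\<Sum>i<n. \<Sum>j<n. \<Sum>a<d. \<Sum>b<d. \<integral>R. c i a j b * (\<Sum>k<r. v R i a k * v R j b k) \<partial>?M) = ?I"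
    unfolding obj_v by (intro integral_sum4[symmetric] integrable_mult_right vv) auto
  finally show "?I \<ge> ?\<alpha>\<^sup>2 * obj n d C X" by simp
qed

theorem theorem4:
  fixes d r n :: nat and C :: "real mat" and X :: "nat \<Rightarrow> real mat"
  assumes "1 \<le> d" and "d \<le> r" and "1 \<le> n"
    and "psd (n * d) C"
    and "\<forall>i<n. X i \<in> carrier_mat d (n * d) \<and> X i * transpose_mat (X i) = 1\<^sub>m d"
    and "\<forall>Y. (\<forall>i<n. Y i \<in> carrier_mat d (n * d) \<and> Y i * transpose_mat (Y i) = 1\<^sub>m d)
              \<longrightarrow> obj n d C Y \<le> obj n d C X"
  shows "(\<integral>R. obj n d C (\<lambda>i. stiefel_proj d r (X i * to_mat (n * d) r R))
            \<partial>gauss_entries (n * d) r (1 / real r))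
         \<ge> (alpha_R d r)\<^sup>2 *
           (SUP Q \<in> {Q. \<forall>i<n. Q i \<in> stiefel d r}. obj n d C Q)"
proof -
  let ?M = "gauss_index (sqrt (1 / real r)) (mat_index (n * d) r)"
  let ?F = "\<lambda>R. obj n d C (\<lambda>i. newton_schulz_limit d r (X i * to_mat (n * d) r R))"
  have X: "\<And>i. i < n \<Longrightarrow> X i \<in> carrier_mat d (n * d)" "\<And>i. i < n \<Longrightarrow> X i * transpose_mat (X i) = 1\<^sub>m d"
    using assms(5) by auto
  have \<sigma>: "sqrt (1 / real r) > 0" using assms(1,2) by simp
  have "(SUP Q \<in> {Q. \<forall>i<n. Q i \<in> stiefel d r}. obj n d C Q) \<le> obj n d C X"
  proof (rule cSUP_least)
    \<comment> \<open>The least upper bound argument needs a feasible point. The matrix [1 0] is one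
      because d is at most r.\<close>
    have "mat d r (\<lambda>(i, j). if i = j then 1 else 0) \<in> stiefel d r"
      unfolding stiefel_def using assms(2)
      by (auto simp: scalar_prod_def if_distrib[of "\<lambda>x. x * _"] intro!: eq_matI cong: if_cong)
    then show "{Q. \<forall>i<n. Q i \<in> stiefel d r} \<noteq> {}" 
      by (auto intro!: exI[of _ "\<lambda>_. mat d r (\<lambda>(i, j). if i = j then 1 else 0)"])
    fix Q assume "Q \<in> {Q. \<forall>i<n. Q i \<in> stiefel d r}"
    then obtain Y where "\<And>i. i < n \<Longrightarrow> Y i \<in> carrier_mat d (n * d) \<and> Y i * transpose_mat (Y i) = 1\<^sub>m d"
      "obj n d C Y = obj n d C Q"
      using stiefel_obj_realized[of n Q d r C] by auto
    then show "obj n d C Q \<le> obj n d C X" using assms(6) by metis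
  qed
  then have "(alpha_R d r)\<^sup>2 * (SUP Q \<in> {Q. \<forall>i<n. Q i \<in> stiefel d r}. obj n d C Q)
      \<le> (alpha_R d r)\<^sup>2 * obj n d C X"
    by (intro mult_left_mono) auto
  also have "\<dots> \<le> (\<integral>R. ?F R \<partial>?M)" by (rule integral_obj_polar_ge(1)[OF assms(1,2,4) X])
  also have "(\<integral>R. ?F R \<partial>?M) = (\<integral>R. obj n d C (\<lambda>i. stiefel_proj d r (X i * to_mat (n * d) r R))
            \<partial>gauss_entries (n * d) r (1 / real r))"
    unfolding gauss_entries_def
  proof (rule integral_completion_AE[symmetric])
    show "?F \<in> borel_measurable ?M" by (rule integral_obj_polar_ge(2)[OF assms(1,2,4) X])
    \<comment> \<open>Only finitely many i occur, so almost surely all X i R have a decomposition at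
      once, and there the measurable limit agrees with the projection.\<close>
    have "AE R in ?M. \<forall>i\<in>{..<n}. \<exists>U s E. svd d r (X i * to_mat (n * d) r R) U s E"
      by (intro AE_finite_allI AE_gauss_svd[OF assms(2) \<sigma>] X) auto
    then show "AE R in ?M. obj n d C (\<lambda>i. stiefel_proj d r (X i * to_mat (n * d) r R)) = ?F R"
      by eventually_elim (simp add: obj_def newton_schulz_limit_in_stiefel(2))
  qed
  finally show ?thesis .
qed

end
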